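(* Let $K$ be a field and let $0\neq q\in K$ be such that, for $n\in\mathbb{Z}$, $\{n\}_q=0$ if and only if $n=0$. Let $$P=\sum_{j=0}^m p_j(M)D_q^j,\qquad Q=\sum_{j=0}^n q_j(M)D_q^j,\qquad p_j,q_j\in K[X],\ p_m\neq 0,\ q_n\neq 0,$$ be commuting elements of $H_K(q)$ of order $m\geq 1$ and $n\geq 1$, respectively. Let $\Delta_{P,Q}(X,\lambda,\mu)\in K[X,\lambda,\mu]$ be the eliminant of $P$ and $Q$, and put $$s=n\max_j\deg(p_j)+m\max_j\deg(q_j),\qquad t=\tfrac12 n(n-1)\max_j\deg(p_j)+\tfrac12 m(m-1)\max_j\deg(q_j).$$ Then $\Delta_{P,Q}\neq 0$. In fact, $\Delta_{P,Q}$ has degree $n$ as an element of $K[X,\mu][\lambda]$, and its non-zero coefficient of $\lambda^n$ is $(-1)^n\prod_{k=0}^{m-1}q_n(q^kX)$. Likewise, $\Delta_{P,Q}$ has degree $m$ as an element of $K[X,\lambda][\mu]$, and its non-zero coefficient of $\mu^m$ is $(-1)^m\prod_{k=0}^{n-1}p_m(q^kX)$. As an element of $K[\lambda,\mu][X]$, $\Delta_{P,Q}$ has degree at most $s$; define $\delta_i\in K[\lambda,\mu]$ $(i=0,\ldots,s)$ by $\Delta_{P,Q}(X,\lambda,\mu)=\sum_{i=0}^s\delta_i(\lambda,\mu)X^i$. Furthermore: (1) if $R$ is the subring of $K$ generated by the coefficients of all polynomials $p_{i,j}$ and $q_{i,j}$ occurring in the matrix defining the eliminant, then the $\delta_i$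 are elements of $R[q][\lambda,\mu]$; in fact, when the $\delta_i$ are viewed as polynomials in $\lambda$ and $\mu$, each of their coefficients can be written as $\sum_{l=0}^t r_lq^l$ for some $r_l\in R$ $(l=0,\ldots,t)$; (2) at least one of the $\delta_i$ is non-zero; (3) $\delta_i(P,Q)=0$ for all $i=0,\ldots,s$.
   Context: For $n\in\mathbb{Z}$ the $q$-integer is $\{n\}_q=\frac{q^n-1}{q-1}$ if $q\neq1$ and $\{n\}_q=n$ (in $K$) if $q=1$. $H_K(q)$ is the unital associative $K$-algebra generated by two elements $A,B$ subject to $AB-qBA=I$. Let $\mathcal{L}$ be the $K$-vector space of all formal two-sided Laurent series $\sum_{n=-\infty}^{\infty}a_nt^n$, $a_n\in K$ (i.e. all functions $\mathbb{Z}\to K$), and define endomorphisms of $\mathcal{L}$ by $$M\Big(\sum_n a_nt^n\Big)=\sum_n a_nt^{n+1},\qquad D_q\Big(\sum_n a_nt^n\Big)=\sum_n a_n\{n\}_qt^{n-1}.$$ Sending $A\mapsto D_q$, $B\mapsto M$ makes $\mathcal{L}$ a faithful $H_K(q)$-module, and $H_K(q)$ is identified with its image in $\operatorname{End}_K(\mathcal{L})$. Every non-zero $P\in H_K(q)$ can be written uniquely as $P=\sum_{j=0}^m p_j(M)D_q^j$ with $m\ge0$, $p_j\in K[X]$, $p_m\neq0$; the integer $m$ is the order of $P$. Eliminant: with $P$ of order $m\ge1$ and $Q$ of order $n\ge1$ as in the claim, write $$D_q^kP=\sum_{j=0}^{m+k}p_{k,j}(M)D_q^j\ (k=0,\ldots,n-1),\qquad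 D_q^lQ=\sum_{j=0}^{n+l}q_{l,j}(M)D_q^j\ (l=0,\ldots,m-1),$$ with $p_{k,j},q_{l,j}\in K[X]$. Consider the $(m+n)\times(m+n)$ matrix with entries in $K[X,\lambda,\mu]$ whose columns are indexed by the powers $D_q^0,\ldots,D_q^{m+n-1}$ in increasing order (column $j+1$ corresponds to $D_q^j$) and whose rows are as follows. For $k=1,\ldots,n$, row $k$ consists of the coefficients (with $M$ replaced by $X$) of the powers of $D_q$ in $D_q^{k-1}P-\lambda D_q^{k-1}=\sum_{j=0}^{m+k-1}p_{k-1,j}(M)D_q^j-\lambda D_q^{k-1}$. For $k=n+1,\ldots,n+m$, row $k$ consists of the coefficients (with $M$ replaced by $X$) of the powers of $D_q$ in $D_q^{k-n-1}Q-\mu D_q^{k-n-1}=\sum_{j=0}^{k-1}q_{k-n-1,j}(M)D_q^j-\mu D_q^{k-n-1}$. Missing coefficients are $0$. The determinant of this matrix is the eliminant $\Delta_{P,Q}(X,\lambda,\mu)$. For a polynomial $\delta\in K[\lambda,\mu]$, $\delta(P,Q)$ denotes the element of $H_K(q)$ obtained by substituting the commuting elements $P,Q$ for $\lambda,\mu$.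
   Formalization: The coefficient of μ^m is stated with sign (-1)^{m(n+1)} instead of (-1)^m; the latter fails for m=n=1, P=Q=D_q with char K≠2, where the eliminant is μ-λ. *)

theory Defs
  imports
    "HOL-Computational_Algebra.Polynomial"
    "Jordan_Normal_Form.Determinant"
begin

section \<open>Endomorphisms of the space of two-sided formal Laurent series\<close>

text \<open>A series \<open>\<Sum>n. a n * t^n\<close> over all integers \<open>n\<close> is the function \<open>a :: int \<Rightarrow> 'a\<close>.\<close>

typedef (overloaded) 'a laurent_end =
  "{T :: (int \<Rightarrow> 'a::field) \<Rightarrow> (int \<Rightarrow> 'a).
      (\<forall>f g. T (\<lambda>n. f n + g n) = (\<lambda>n. T f n + T g n)) \<and>
      (\<forall>c f. T (\<lambda>n. c * f n) = (\<lambda>n. c * T f n))}"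
  morphisms app_end Abs_end
  by (rule exI[of _ "\<lambda>f. f"]) simp

setup_lifting type_definition_laurent_end

text \<open>The ring structure of the endomorphism ring; multiplication is composition.\<close>

instantiation laurent_end :: (field) ring_1
begin

lift_definition zero_laurent_end :: "'a laurent_end" is "\<lambda>f n. 0"
  by simp

lift_definition one_laurent_end :: "'a laurent_end" is "\<lambda>f. f"
  by simp

lift_definition plus_laurent_end :: "'a laurent_end \<Rightarrow> 'a laurent_end \<Rightarrow> 'a laurent_end"
  is "\<lambda>S T f n. S f n + T f n"
  by (auto simp: algebra_simps)

lift_definition uminus_laurent_end :: "'a laurent_end \<Rightarrow> 'a laurent_end"
  is "\<lambda>S f n. - S f n"
  by auto

lift_definition minus_laurent_end :: "'a laurent_end \<Rightarrow> 'a laurent_end \<Rightarrow> 'a laurent_end"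
  is "\<lambda>S T f n. S f n - T f n"
  by (auto simp: algebra_simps)

lift_definition times_laurent_end :: "'a laurent_end \<Rightarrow> 'a laurent_end \<Rightarrow> 'a laurent_end"
  is "\<lambda>S T f. S (T f)"
  by auto

instance
proof
  show "(0::'a laurent_end) \<noteq> 1"
    by transfer (metis zero_neq_one)
qed (transfer; auto simp: fun_eq_iff algebra_simps)+

end

lift_definition scalar_end :: "'a::field \<Rightarrow> 'a laurent_end" is "\<lambda>c f n. c * f n"
  by (auto simp: algebra_simps)

lift_definition M_op :: "'a::field laurent_end" is "\<lambda>a n. a (n - 1)"
  by auto

definition q_int :: "'a::field \<Rightarrow> int \<Rightarrow> 'a" where
  "q_int q n = (if q = 1 then of_int n else (q powi n - 1) / (q - 1))"

lift_definition D_op :: "'a::field \<Rightarrow> 'a laurent_end"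
  is "\<lambda>q a n. a (n + 1) * q_int q (n + 1)"
  by (auto simp: algebra_simps)

section \<open>The q-deformed Heisenberg algebra\<close>

text \<open>The algebra generated by \<open>A\<close>, \<open>B\<close> subject to \<open>A B - q B A = 1\<close> is identified with its
  image under the faithful representation sending \<open>A\<close> to \<open>D_op q\<close> and \<open>B\<close> to \<open>M_op\<close>, that is,
  with the unital subalgebra of the endomorphism ring generated by these two operators.\<close>

inductive_set q_heisenberg :: "'a::field \<Rightarrow> 'a laurent_end set" for q :: 'a where
  scalar: "scalar_end c \<in> q_heisenberg q"
| D: "D_op q \<in> q_heisenberg q"
| M: "M_op \<in> q_heisenberg q"
| add: "S \<in> q_heisenberg q \<Longrightarrow> T \<in> q_heisenberg q \<Longrightarrow> S + T \<in> q_heisenberg q"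
| mult: "S \<in> q_heisenberg q \<Longrightarrow> T \<in> q_heisenberg q \<Longrightarrow> S * T \<in> q_heisenberg q"

lemma q_heisenberg_relation:
  assumes "q \<noteq> 0"
  shows "D_op q * M_op - scalar_end q * M_op * D_op q = 1"
proof (transfer fixing: q)
  have "q_int q (n + 1) = 1 + q * q_int q n" for n
    using assms by (simp add: q_int_def power_int_add field_simps)
  then show "(\<lambda>f n. f (n + 1 - 1) * q_int q (n + 1)
                 - q * (f (n - 1 + 1) * q_int q (n - 1 + 1))) = (\<lambda>f. f)"
    by (auto simp: fun_eq_iff algebra_simps)
qed

definition poly_end :: "'a::field poly \<Rightarrow> 'a laurent_end \<Rightarrow> 'a laurent_end" where
  "poly_end p T = (\<Sum>i\<le>degree p. scalar_end (coeff p i) * T ^ i)"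

text \<open>The operator \<open>\<Sum>j\<le>N. c j (M) D^j\<close>.\<close>

definition normal_form :: "'a::field \<Rightarrow> nat \<Rightarrow> (nat \<Rightarrow> 'a poly) \<Rightarrow> 'a laurent_end" where
  "normal_form q N c = (\<Sum>j\<le>N. poly_end (c j) M_op * D_op q ^ j)"

text \<open>The coefficients in \<open>K[X]\<close> of the powers of \<open>D_op q\<close> in the unique expansion of an element
  of the algebra, extended by \<open>0\<close>.\<close>

definition D_coeff :: "'a::field \<Rightarrow> 'a laurent_end \<Rightarrow> nat \<Rightarrow> 'a poly" where
  "D_coeff q T = (THE c. \<exists>N. T = normal_form q N c \<and> (\<forall>j>N. c j = 0))"

text \<open>A polynomial \<open>\<delta> \<in> K[\<lambda>,\<mu>]\<close> is an element of \<open>K[\<lambda>][\<mu>]\<close>: the coefficient of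
  \<open>\<lambda>^a * \<mu>^b\<close> is \<open>coeff (coeff \<delta> b) a\<close>. Substitution of \<open>P\<close>, \<open>Q\<close> for \<open>\<lambda>\<close>, \<open>\<mu>\<close>:\<close>

definition poly2_end ::
    "'a::field poly poly \<Rightarrow> 'a laurent_end \<Rightarrow> 'a laurent_end \<Rightarrow> 'a laurent_end" where
  "poly2_end \<delta> P Q = (\<Sum>b\<le>degree \<delta>. poly_end (coeff \<delta> b) P * Q ^ b)"

section \<open>The eliminant\<close>

text \<open>\<open>K[X,\<lambda>,\<mu>]\<close> is represented as \<open>K[X][\<lambda>][\<mu>]\<close>, the outermost variable being \<open>\<mu>\<close>.
  Indices of rows and columns start at \<open>0\<close>. The entries \<open>-\<lambda>\<close> lie on the main diagonal, whereas
  the entries \<open>-\<mu>\<close> lie on the diagonal of the lower left \<open>m \<times> m\<close> block; the complementary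
  \<open>n \<times> n\<close> minor therefore enters the coefficient of \<open>\<mu>^m\<close> with the sign \<open>(-1)^(m * n)\<close> in
  addition to the factor \<open>(-1)^m\<close>.\<close>

definition eliminant_mat :: "'a::field \<Rightarrow> nat \<Rightarrow> nat \<Rightarrow> 'a laurent_end \<Rightarrow> 'a laurent_end
    \<Rightarrow> 'a poly poly poly mat" where
  "eliminant_mat q m n P Q =
     (let lam = [:[:0, 1:]:]; mu = [:0, 1:] in
      mat (m + n) (m + n) (\<lambda>(i, j).
        if i < n
        then [:[:D_coeff q (D_op q ^ i * P) j:]:] - (if j = i then lam else 0)
        else [:[:D_coeff q (D_op q ^ (i - n) * Q) j:]:] - (if j = i - n then mu else 0)))"

definition eliminant :: "'a::field \<Rightarrow> nat \<Rightarrow> nat \<Rightarrow> 'a laurent_end \<Rightarrow> 'a laurent_end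
    \<Rightarrow> 'a poly poly poly" where
  "eliminant q m n P Q = det (eliminant_mat q m n P Q)"

text \<open>The canonical isomorphism from \<open>R[x][y]\<close> to \<open>R[y][x]\<close>.\<close>

definition poly_swap :: "'b::comm_ring_1 poly poly \<Rightarrow> 'b poly poly" where
  "poly_swap p =
     (\<Sum>j\<le>degree p. \<Sum>i\<le>degree (coeff p j). monom (monom (coeff (coeff p j) i) j) i)"

lemma coeff_poly_swap: "coeff (coeff (poly_swap p) i) j = coeff (coeff p j) i"
proof -
  have inner: "(\<Sum>i'\<le>degree (coeff p j'). coeff (coeff (monom (monom (coeff (coeff p j') i') j') i') i) j)
      = (if j' = j then coeff (coeff p j) i else 0)" for j'
  proof -
    have "(\<Sum>i'\<le>degree (coeff p j'). coeff (coeff (monom (monom (coeff (coeff p j') i') j') i') i) j)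
        = (\<Sum>i'\<le>degree (coeff p j'). if i' = i then (if j' = j then coeff (coeff p j') i else 0) else 0)"
      by (rule sum.cong) auto
    also have "\<dots> = (if j' = j then coeff (coeff p j) i else 0)"
      by (auto simp: sum.delta coeff_eq_0)
    finally show ?thesis .
  qed
  show ?thesis
    unfolding poly_swap_def coeff_sum inner by (auto simp: sum.delta coeff_eq_0)
qed

text \<open>From \<open>K[X][\<lambda>][\<mu>]\<close> to \<open>K[X][\<mu>][\<lambda>]\<close>.\<close>

definition as_poly_in_lambda :: "'a::field poly poly poly \<Rightarrow> 'a poly poly poly" where
  "as_poly_in_lambda \<Delta> = poly_swap \<Delta>"

text \<open>From \<open>K[X][\<lambda>][\<mu>]\<close> to \<open>K[\<lambda>][\<mu>][X]\<close>, by way of \<open>K[\<lambda>][X][\<mu>]\<close>.\<close>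

definition as_poly_in_X :: "'a::field poly poly poly \<Rightarrow> 'a poly poly poly" where
  "as_poly_in_X \<Delta> = poly_swap (map_poly poly_swap \<Delta>)"

lemma coeff_as_poly_in_lambda:
  "coeff (coeff (coeff (as_poly_in_lambda \<Delta>) a) b) i = coeff (coeff (coeff \<Delta> b) a) i"
  by (simp add: as_poly_in_lambda_def coeff_poly_swap)

lemma coeff_as_poly_in_X:
  "coeff (coeff (coeff (as_poly_in_X \<Delta>) i) b) a = coeff (coeff (coeff \<Delta> b) a) i"
proof -
  have "poly_swap 0 = (0 :: 'a poly poly)"
    by (simp add: poly_swap_def)
  then show ?thesis
    by (simp add: as_poly_in_X_def coeff_poly_swap coeff_map_poly)
qed

section \<open>Generated subrings\<close>

definition gen_subring :: "'a::comm_ring_1 set \<Rightarrow> 'a set" where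
  "gen_subring S = \<Inter>{R. S \<subseteq> R \<and> 1 \<in> R \<and>
     (\<forall>x\<in>R. \<forall>y\<in>R. x - y \<in> R) \<and> (\<forall>x\<in>R. \<forall>y\<in>R. x * y \<in> R)}"

text \<open>All coefficients of the polynomials in \<open>K[X]\<close> occurring in the eliminant matrix.\<close>

definition eliminant_coeffs :: "'a::field \<Rightarrow> nat \<Rightarrow> nat \<Rightarrow> 'a laurent_end \<Rightarrow> 'a laurent_end
    \<Rightarrow> 'a set" where
  "eliminant_coeffs q m n P Q =
     {coeff (D_coeff q (D_op q ^ k * P) j) i | k j i. k < n \<and> j \<le> m + k} \<union>
     {coeff (D_coeff q (D_op q ^ l * Q) j) i | l j i. l < m \<and> j \<le> n + l}"

end

theory Submission
  imports Defs
begin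

text \<open>Let \<open>X\<close> act on the endomorphism ring by left multiplication by \<open>M\<close>, and \<open>\<lambda>\<close>, \<open>\<mu>\<close> by right
  multiplication by \<open>P\<close>, \<open>Q\<close>. Since \<open>P\<close> and \<open>Q\<close> commute, this is a module over \<open>K[X,\<lambda>,\<mu>]\<close>, and the
  matrix of the eliminant kills the vector of powers of \<open>D\<close>. Hence its determinant kills \<open>1\<close>, which
  says that \<open>\<Sum>i. M^i * \<delta> i (P, Q) = 0\<close>.

  The operators \<open>\<delta> i (P, Q)\<close> commute with \<open>P\<close>. If \<open>C\<close> has order \<open>d\<close> and commutes with \<open>P\<close>,
  comparing the highest coefficients that do not agree trivially in \<open>P * C\<close> and \<open>C * P\<close> shows that the
  leading coefficient \<open>c\<close> of \<open>C\<close> satisfies \<open>m * degree c = d * degree p\<close>, where \<open>p\<close> is the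
  leading coefficient of \<open>P\<close>. So \<open>degree c\<close> depends on \<open>d\<close> only, the contributions of the different
  \<open>M^i\<close> to the highest order have different degrees, and every \<open>\<delta> i (P, Q)\<close> vanishes.

  The coefficients of \<open>\<lambda>^n\<close> and \<open>\<mu>^m\<close> are determinants of matrices that are lower triangular, in the
  second case after moving the last rows to the top.\<close>

section \<open>Modules over polynomial rings\<close>

text \<open>A module with an endomorphism \<open>T\<close> becomes a module over the polynomial
  ring, the variable acting as \<open>T\<close>. Iterating this adjoins one variable at a
  time.\<close>

definition poly_scale ::
    "('r::comm_ring_1 \<Rightarrow> 'b::ab_group_add \<Rightarrow> 'b) \<Rightarrow> ('b \<Rightarrow> 'b) \<Rightarrow> 'r poly \<Rightarrow> 'b \<Rightarrow> 'b" where
  "poly_scale s T p v = (\<Sum>i\<le>degree p. s (coeff p i) ((T ^^ i) v))"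

locale module_endo = Modules.module s
  for s :: "'r::comm_ring_1 \<Rightarrow> 'b::ab_group_add \<Rightarrow> 'b" +
  fixes T :: "'b \<Rightarrow> 'b"
  assumes endo_add: "T (x + y) = T x + T y"
    and endo_scale: "T (s a x) = s a (T x)"
begin

lemma endo_zero: "T 0 = 0"
  using endo_add[of 0 0] by simp

lemma endo_sum: "T (sum f A) = (\<Sum>i\<in>A. T (f i))"
  by (induction A rule: infinite_finite_induct) (simp_all add: endo_zero endo_add)

lemma poly_scale_upto:
  assumes "degree p \<le> N"
  shows "poly_scale s T p v = (\<Sum>i\<le>N. s (coeff p i) ((T ^^ i) v))"
  unfolding poly_scale_def
  by (rule sum.mono_neutral_left) (use assms in \<open>auto simp: coeff_eq_0\<close>)

lemma poly_scale_0: "poly_scale s T 0 v = 0"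
  by (simp add: poly_scale_def)

lemma poly_scale_pCons: "poly_scale s T (pCons a p) v = s a v + T (poly_scale s T p v)"
proof -
  have "poly_scale s T (pCons a p) v
      = (\<Sum>i\<le>Suc (degree p). s (coeff (pCons a p) i) ((T ^^ i) v))"
    by (rule poly_scale_upto) (rule degree_pCons_le)
  also have "\<dots> = s a v + (\<Sum>i\<le>degree p. s (coeff p i) (T ((T ^^ i) v)))"
    by (simp add: sum.atMost_Suc_shift del: sum.atMost_Suc)
  also have "\<dots> = s a v + T (poly_scale s T p v)"
    by (simp add: poly_scale_def endo_sum endo_scale)
  finally show ?thesis .
qed

lemma poly_scale_const: "poly_scale s T [:a:] v = s a v"
  by (simp add: poly_scale_pCons poly_scale_0 endo_zero)

lemma poly_scale_commute:
  assumes add: "\<And>x y. U (x + y) = U x + U y"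
    and scale: "\<And>a x. U (s a x) = s a (U x)"
    and comm: "\<And>x. U (T x) = T (U x)"
  shows "U (poly_scale s T p v) = poly_scale s T p (U v)"
proof (induction p)
  case 0
  have "U 0 = 0" using add[of 0 0] by simp
  then show ?case by (simp add: poly_scale_0)
qed (simp add: poly_scale_pCons add scale comm)

lemma poly_scale_add_right: "poly_scale s T p (v + w) = poly_scale s T p v + poly_scale s T p w"
  by (induction p) (simp_all add: poly_scale_0 poly_scale_pCons endo_add scale_right_distrib)

lemma poly_scale_add_left: "poly_scale s T (p + r) v = poly_scale s T p v + poly_scale s T r v"
proof -
  define N where "N = max (degree p) (degree r)"
  have "degree p \<le> N" "degree r \<le> N" "degree (p + r) \<le> N"
    by (simp_all add: N_def degree_add_le_max)
  then show ?thesis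
    by (simp add: poly_scale_upto[of _ N] scale_left_distrib sum.distrib)
qed

lemma poly_scale_smult: "poly_scale s T (smult a p) v = s a (poly_scale s T p v)"
  by (induction p) (simp_all add: poly_scale_0 poly_scale_pCons scale_right_distrib endo_scale)

lemma poly_scale_mult: "poly_scale s T (p * r) v = poly_scale s T p (poly_scale s T r v)"
  by (induction p)
    (simp_all add: poly_scale_0 poly_scale_pCons poly_scale_add_left poly_scale_smult mult_pCons_left)

lemma module_poly_scale: "Modules.module (poly_scale s T)"
proof
  show "poly_scale s T 1 x = x" for x
    by (simp add: poly_scale_const one_pCons)
qed (simp_all add: poly_scale_add_right poly_scale_add_left poly_scale_mult)

text \<open>An endomorphism that commutes with \<open>T\<close> stays linear over the larger ring,
  so it can serve as the action of the next variable.\<close>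

lemma module_endo_poly_scale:
  assumes "\<And>x y. U (x + y) = U x + U y" "\<And>a x. U (s a x) = s a (U x)" "\<And>x. U (T x) = T (U x)"
  shows "module_endo (poly_scale s T) U"
  by (intro module_endo.intro module_poly_scale module_endo_axioms.intro assms
      poly_scale_commute)

end

text \<open>Multiplying by the adjugate from the left turns \<open>A\<close> into
  \<open>det A\<close> times the identity.\<close>

lemma (in Modules.module) det_scale_eq_0:
  assumes A: "A \<in> carrier_mat N N"
    and ker: "\<And>i. i < N \<Longrightarrow> (\<Sum>j<N. scale (A $$ (i, j)) (v j)) = 0"
    and k: "k < N"
  shows "scale (det A) (v k) = 0"
proof -
  let ?B = "adj_mat A"
  have B: "?B \<in> carrier_mat N N" using adj_mat(1)[OF A] .
  have entry: "(if k = j then det A else 0) = (\<Sum>i<N. ?B $$ (k, i) * A $$ (i, j))"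
    if j: "j < N" for j
  proof -
    have "(?B * A) $$ (k, j) = (if k = j then det A else 0)"
      using adj_mat(3)[OF A] j k by simp
    moreover have "(?B * A) $$ (k, j) = (\<Sum>i<N. ?B $$ (k, i) * A $$ (i, j))"
      using A B j k by (simp add: scalar_prod_def atLeast0LessThan)
    ultimately show ?thesis by simp
  qed
  have "scale (det A) (v k) = (\<Sum>j<N. scale (if k = j then det A else 0) (v j))"
  proof -
    have "(\<Sum>j<N. scale (if k = j then det A else 0) (v j))
        = (\<Sum>j<N. if k = j then scale (det A) (v j) else 0)"
      by (rule sum.cong) auto
    then show ?thesis using k by simp
  qed
  also have "\<dots> = (\<Sum>j<N. \<Sum>i<N. scale (?B $$ (k, i)) (scale (A $$ (i, j)) (v j)))"
    by (rule sum.cong) (simp_all add: entry scale_sum_left)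
  also have "\<dots> = (\<Sum>i<N. scale (?B $$ (k, i)) (\<Sum>j<N. scale (A $$ (i, j)) (v j)))"
    unfolding scale_sum_right by (rule sum.swap)
  also have "\<dots> = 0" by (simp add: ker)
  finally show ?thesis .
qed

section \<open>Normal forms in the q-deformed Heisenberg algebra\<close>

lemma scalar_end_hom:
  "scalar_end (a + b) = scalar_end a + scalar_end b"
  "scalar_end (a * b) = scalar_end a * scalar_end b"
  "scalar_end 1 = 1" "scalar_end 0 = 0"
  by (transfer; auto simp: fun_eq_iff algebra_simps)+

lemma scalar_end_commute: "scalar_end a * T = T * scalar_end a"
  by transfer auto

lemma scalar_end_left_commute: "T * (scalar_end a * U) = scalar_end a * (T * U)"
  by (metis mult.assoc scalar_end_commute)

lemma module_scalar_end: "Modules.module (\<lambda>c v. scalar_end c * v)"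
  by standard (simp_all add: scalar_end_hom distrib_left distrib_right mult.assoc)

lemma module_endo_left_mult: "module_endo (\<lambda>c v. scalar_end c * v) ((*) T)"
  by (intro module_endo.intro module_scalar_end module_endo_axioms.intro)
    (simp_all add: distrib_left scalar_end_left_commute)

text \<open>Makes evaluation at \<open>T\<close> an instance of the general construction; the laws
  of evaluation are then module laws applied to the vector \<open>1\<close>.\<close>

lemma poly_end_mult_eq_poly_scale:
  "poly_end p T * v = poly_scale (\<lambda>c v. scalar_end c * v) ((*) T) p v"
proof -
  have "((*) T ^^ i) v = T ^ i * v" for i
    by (induction i) (simp_all add: mult.assoc)
  then show ?thesis
    by (simp add: poly_end_def poly_scale_def sum_distrib_right mult.assoc)
qed

lemma module_poly_end: "Modules.module (\<lambda>p v. poly_end p T * v)"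
  unfolding poly_end_mult_eq_poly_scale
  by (rule module_endo.module_poly_scale[OF module_endo_left_mult])

lemma poly_end_0: "poly_end 0 T = 0"
  and poly_end_1: "poly_end 1 T = 1"
  and poly_end_add: "poly_end (p + r) T = poly_end p T + poly_end r T"
  and poly_end_mult: "poly_end (p * r) T = poly_end p T * poly_end r T"
proof -
  interpret Modules.module "\<lambda>p v. poly_end p T * v" by (rule module_poly_end)
  show "poly_end 0 T = 0" using scale_zero_left[of 1] by simp
  show "poly_end 1 T = 1" using scale_one[of 1] by simp
  show "poly_end (p + r) T = poly_end p T + poly_end r T"
    using scale_left_distrib[of p r 1] by simp
  show "poly_end (p * r) T = poly_end p T * poly_end r T"
    using scale_scale[of p r 1] by simp
qed

lemma poly_end_pCons: "poly_end (pCons a p) T = scalar_end a + T * poly_end p T"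
  using module_endo.poly_scale_pCons[OF module_endo_left_mult, of T a p 1]
  by (simp flip: poly_end_mult_eq_poly_scale)

lemma poly_end_const: "poly_end [:a:] T = scalar_end a"
  by (simp add: poly_end_pCons poly_end_0)

lemma poly_end_upto: "degree p \<le> N \<Longrightarrow> poly_end p T = (\<Sum>i\<le>N. scalar_end (coeff p i) * T ^ i)"
  unfolding poly_end_def by (rule sum.mono_neutral_left) (auto simp: coeff_eq_0 scalar_end_hom)

lemma poly_end_X: "poly_end [:0, 1:] T = T"
  by (simp add: poly_end_pCons poly_end_0 scalar_end_hom)

lemma poly_end_X_power: "poly_end (monom 1 i) T = T ^ i"
  by (induction i) (simp_all add: monom_0 monom_Suc poly_end_pCons scalar_end_hom poly_end_1 flip: one_pCons)

lemma app_end_zero_right: "app_end T (\<lambda>n. 0) = (\<lambda>n. 0)"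
proof -
  have "\<forall>c f. app_end T (\<lambda>n. c * f n) = (\<lambda>n. c * app_end T f n)"
    using app_end[of T] by simp
  from this[rule_format, of 0] show ?thesis by simp
qed

lemma app_end_sum: "app_end (sum f A) v n = (\<Sum>i\<in>A. app_end (f i) v n)"
  by (induction A rule: infinite_finite_induct)
    (simp_all add: zero_laurent_end.rep_eq plus_laurent_end.rep_eq)

text \<open>\<open>M_op ^ i\<close> sends the constant series 1 to \<open>t^i\<close>, so the
  operator of \<open>p\<close> sends it to the series of \<open>p\<close> itself.\<close>

lemma app_poly_end_M_op:
  "app_end (poly_end p M_op) (\<lambda>n. if n = 0 then 1 else 0) (int k) = coeff p k"
proof -
  have M: "app_end (M_op ^ i) (\<lambda>n. if n = 0 then 1 else 0)
      = (\<lambda>n::int. if n = int i then (1::'a) else 0)" for i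
    by (induction i) (auto simp: one_laurent_end.rep_eq times_laurent_end.rep_eq M_op.rep_eq fun_eq_iff)
  have "app_end (poly_end p M_op) (\<lambda>n. if n = 0 then 1 else 0) (int k)
      = (\<Sum>i\<le>degree p. if k = i then coeff p i else 0)"
    unfolding poly_end_def app_end_sum
    by (rule sum.cong) (auto simp: times_laurent_end.rep_eq scalar_end.rep_eq M)
  also have "\<dots> = coeff p k" by (simp add: coeff_eq_0)
  finally show ?thesis .
qed

section \<open>Normal forms as polynomials in \<open>D_op q\<close> over \<open>K[X]\<close>\<close>

abbreviation M_scale :: "'a::field poly \<Rightarrow> 'a laurent_end \<Rightarrow> 'a laurent_end" where
  "M_scale \<equiv> \<lambda>p v. poly_end p M_op * v"

text \<open>Left and right multiplications commute by associativity. Used with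
  \<open>U = D_op q\<close> for normal forms and with \<open>U = P\<close> for the action of
  \<lambda>.\<close>

lemma module_endo_right_mult: "module_endo M_scale (\<lambda>v. v * U)"
  by (intro module_endo.intro module_poly_end module_endo_axioms.intro)
    (simp_all add: distrib_right mult.assoc)

text \<open>A polynomial in \<open>K[X][Y]\<close> stands for the operator obtained by substituting \<open>M\<close> for \<open>X\<close>
  and \<open>D\<close> for \<open>Y\<close>, with the powers of \<open>M\<close> on the left.\<close>

definition normal_op :: "'a::field \<Rightarrow> 'a poly poly \<Rightarrow> 'a laurent_end" where
  "normal_op q c = normal_form q (degree c) (coeff c)"

lemma right_mult_funpow: "((\<lambda>v. v * U) ^^ i) w = w * U ^ i" for U :: "'a::monoid_mult"
  by (induction i) (simp_all add: mult.assoc power_commutes)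

lemma normal_op_eq_poly_scale: "normal_op q c = poly_scale M_scale (\<lambda>v. v * D_op q) c 1"
  by (simp add: normal_op_def normal_form_def poly_scale_def right_mult_funpow)

lemma normal_op_upto: "degree c \<le> N \<Longrightarrow> normal_op q c = normal_form q N (coeff c)"
  by (simp add: normal_op_eq_poly_scale module_endo.poly_scale_upto[OF module_endo_right_mult]
      normal_form_def right_mult_funpow)

lemma normal_op_0: "normal_op q 0 = 0"
  by (simp add: normal_op_def normal_form_def poly_end_0)

lemma normal_op_add: "normal_op q (c + d) = normal_op q c + normal_op q d"
  by (simp add: normal_op_eq_poly_scale module_endo.poly_scale_add_left[OF module_endo_right_mult])

lemma normal_op_sum: "normal_op q (sum f A) = (\<Sum>i\<in>A. normal_op q (f i))"
  by (induction A rule: infinite_finite_induct) (simp_all add: normal_op_0 normal_op_add)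

lemma normal_op_smult: "normal_op q (smult p c) = poly_end p M_op * normal_op q c"
  by (simp add: normal_op_eq_poly_scale module_endo.poly_scale_smult[OF module_endo_right_mult])

lemma normal_op_pCons: "normal_op q (pCons p c) = poly_end p M_op + normal_op q c * D_op q"
  by (simp add: normal_op_eq_poly_scale module_endo.poly_scale_pCons[OF module_endo_right_mult])

text \<open>The Jackson derivative: \<open>(p(qX) - p(X)) / ((q - 1) X)\<close> for
  \<open>q \<noteq> 1\<close>, the usual derivative for \<open>q = 1\<close>. The last summand is
  zero; including it avoids the index \<open>degree p - 1\<close>.\<close>

definition q_pderiv :: "'a::field \<Rightarrow> 'a poly \<Rightarrow> 'a poly" where
  "q_pderiv q p = (\<Sum>i\<le>degree p. monom (q_int q (int i + 1) * coeff p (Suc i)) i)"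

lemma coeff_q_pderiv: "coeff (q_pderiv q p) i = q_int q (int i + 1) * coeff p (Suc i)"
  by (auto simp: q_pderiv_def coeff_sum coeff_eq_0)

abbreviation q_dilate :: "'a::field \<Rightarrow> 'a poly \<Rightarrow> 'a poly" where
  "q_dilate q p \<equiv> pcompose p [:0, q:]"

lemma q_int_Suc:
  assumes "q \<noteq> 0"
  shows "q_int q (k + 1) = 1 + q * q_int q k"
  using assms by (simp add: q_int_def power_int_add field_simps)

lemma q_int_0: "q_int q 0 = 0"
  by (simp add: q_int_def)

text \<open>The q-Leibniz rule, obtained by moving \<open>D_op q\<close> past one factor
  \<open>M_op\<close> at a time with the defining relation.\<close>

lemma D_op_poly_end:
  assumes "q \<noteq> 0"
  shows "D_op q * poly_end p M_op
    = poly_end (q_dilate q p) M_op * D_op q + poly_end (q_pderiv q p) M_op"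
proof (induction p)
  case 0
  have "q_pderiv q 0 = 0" by (simp add: poly_eq_iff coeff_q_pderiv)
  then show ?case by (simp add: poly_end_0)
next
  case (pCons a p)
  have dil: "q_dilate q (pCons a p) = pCons a (smult q (q_dilate q p))"
    by (simp add: pcompose_pCons)
  \<comment> \<open>The coefficients agree because
    \<open>q_int q (i + 1) = 1 + q * q_int q i\<close>; at \<open>i = 0\<close> the shifted term is
    absent, matching \<open>q_int q 0 = 0\<close>.\<close>
  have der: "q_pderiv q (pCons a p) = p + pCons 0 (smult q (q_pderiv q p))"
  proof (rule poly_eqI)
    fix i
    show "coeff (q_pderiv q (pCons a p)) i = coeff (p + pCons 0 (smult q (q_pderiv q p))) i"
      using q_int_Suc[OF assms, of "int i"]
      by (cases i) (simp_all add: coeff_q_pderiv q_int_0 algebra_simps)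
  qed
  have smult: "poly_end (smult q r) M_op = scalar_end q * poly_end r M_op" for r
    using poly_end_mult[of "[:q:]" r M_op] by (simp add: poly_end_const)
  have DM: "D_op q * M_op = scalar_end q * M_op * D_op q + 1"
    using q_heisenberg_relation[OF assms] by (simp add: algebra_simps)
  have "D_op q * poly_end (pCons a p) M_op
      = scalar_end a * D_op q + (D_op q * M_op) * poly_end p M_op"
    by (simp add: poly_end_pCons distrib_left scalar_end_commute mult.assoc)
  also have "\<dots> = scalar_end a * D_op q + scalar_end q * M_op * (D_op q * poly_end p M_op)
      + poly_end p M_op"
    by (simp add: DM distrib_right mult.assoc)
  also have "\<dots> = poly_end (q_dilate q (pCons a p)) M_op * D_op q
      + poly_end (q_pderiv q (pCons a p)) M_op"
    unfolding pCons.IH dil der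
    by (simp add: poly_end_pCons poly_end_add smult distrib_left distrib_right mult.assoc
        scalar_end_hom add_ac scalar_end_left_commute[of M_op])
  finally show ?case .
qed

text \<open>The constant series is killed by \<open>D_op q\<close>, so it reveals the lowest
  coefficient. Once that is zero, a factor \<open>D_op q\<close> on the right can be cancelled by
  solving \<open>D f = g\<close>.\<close>

lemma normal_op_eq_0:
  assumes q: "\<forall>k. q_int q k = 0 \<longleftrightarrow> k = 0"
    and "normal_op q c = 0"
  shows "c = 0"
proof -
  \<comment> \<open>The induction tests on power series only: \<open>D_op q\<close> never produces a
    term \<open>t^(-1)\<close>, but it reaches every power series.\<close>
  have "c = 0" if "\<And>f. (\<And>n. n < 0 \<Longrightarrow> f n = 0) \<Longrightarrow> app_end (normal_op q c) f = (\<lambda>n. 0)"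
    using that
  proof (induction c)
    case (pCons p c)
    have p: "p = 0"
    proof (rule poly_eqI)
      fix k
      have D: "app_end (D_op q) (\<lambda>n. if n = 0 then 1 else 0) = (\<lambda>n. 0)"
        using q by (auto simp: D_op.rep_eq fun_eq_iff)
      have "app_end (normal_op q c * D_op q) (\<lambda>n. if n = 0 then 1 else 0) = (\<lambda>n. 0)"
        by (simp add: times_laurent_end.rep_eq D app_end_zero_right)
      then have "app_end (normal_op q (pCons p c)) (\<lambda>n. if n = 0 then 1 else 0) (int k) = coeff p k"
        by (simp add: normal_op_pCons plus_laurent_end.rep_eq app_poly_end_M_op)
      moreover have "app_end (normal_op q (pCons p c)) (\<lambda>n. if n = 0 then 1 else 0) = (\<lambda>n. 0)"
        by (rule pCons.prems) auto
      ultimately show "coeff p k = coeff 0 k" by simp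
    qed
    have "c = 0"
    proof (rule pCons.IH)
      fix g :: "int \<Rightarrow> 'a"
      assume g: "\<And>n. n < 0 \<Longrightarrow> g n = 0"
      \<comment> \<open>The q-antiderivative of \<open>g\<close>. At \<open>n = 0\<close> the
        division by zero gives 0, the constant of integration.\<close>
      define f where "f n = g (n - 1) / q_int q n" for n
      have "app_end (D_op q) f = g"
        using q g by (auto simp: D_op.rep_eq f_def fun_eq_iff)
      moreover have "app_end (normal_op q (pCons p c)) f = (\<lambda>n. 0)"
        by (rule pCons.prems) (simp add: f_def g)
      ultimately show "app_end (normal_op q c) g = (\<lambda>n. 0)"
        by (simp add: normal_op_pCons p poly_end_0 times_laurent_end.rep_eq)
    qed
    with p show ?case by simp
  qed simp
  moreover have "app_end (normal_op q c) f = (\<lambda>n. 0)" for f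
    by (simp add: assms(2) zero_laurent_end.rep_eq)
  ultimately show ?thesis by blast
qed

section \<open>Uniqueness of the normal form\<close>

lemma normal_op_inject:
  assumes "\<forall>k. q_int q k = 0 \<longleftrightarrow> k = 0"
  shows "normal_op q c = normal_op q d \<longleftrightarrow> c = d"
proof
  assume "normal_op q c = normal_op q d"
  then have "normal_op q (c - d) = 0"
    using normal_op_add[of q "c - d" d] by simp
  then show "c = d"
    using normal_op_eq_0[OF assms] by fastforce
qed simp

lemma ex_poly_coeff_eq:
  fixes a :: "nat \<Rightarrow> 'b::comm_monoid_add"
  assumes "\<forall>j>N. a j = 0"
  shows "\<exists>p. degree p \<le> N \<and> coeff p = a"
proof (intro exI conjI)
  show "coeff (\<Sum>j\<le>N. monom (a j) j) = a"
    using assms by (auto simp: coeff_sum fun_eq_iff)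
  then show "degree (\<Sum>j\<le>N. monom (a j) j) \<le> N"
    using assms by (intro degree_le) simp
qed

lemma D_coeff_normal_op:
  assumes "\<forall>k. q_int q k = 0 \<longleftrightarrow> k = 0"
  shows "D_coeff q (normal_op q c) = coeff c"
  unfolding D_coeff_def
proof (rule the_equality)
  show "\<exists>N. normal_op q c = normal_form q N (coeff c) \<and> (\<forall>j>N. coeff c j = 0)"
    by (intro exI[of _ "degree c"]) (simp add: normal_op_def coeff_eq_0)
next
  fix a
  assume "\<exists>N. normal_op q c = normal_form q N a \<and> (\<forall>j>N. a j = 0)"
  then obtain N where N: "normal_op q c = normal_form q N a" "\<forall>j>N. a j = 0" by blast
  then obtain d where d: "degree d \<le> N" "coeff d = a" using ex_poly_coeff_eq by blast
  then have "normal_op q c = normal_op q d" by (simp add: N normal_op_upto)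
  then show "a = coeff c" using d normal_op_inject[OF assms, of c d] by auto
qed

text \<open>Left multiplication by \<open>D_op q\<close> carried over to normal forms. By the
  q-Leibniz rule a coefficient at \<open>D^j\<close> contributes its dilation at
  \<open>D^(j+1)\<close> and its q-derivative at \<open>D^j\<close>.\<close>

definition left_D :: "'a::field \<Rightarrow> 'a poly poly \<Rightarrow> 'a poly poly" where
  "left_D q c = pCons 0 (map_poly (q_dilate q) c) + map_poly (q_pderiv q) c"

lemma q_pderiv_0: "q_pderiv q 0 = 0"
  by (simp add: poly_eq_iff coeff_q_pderiv)

lemma coeff_left_D:
  "coeff (left_D q c) j = coeff (pCons 0 (map_poly (q_dilate q) c)) j + q_pderiv q (coeff c j)"
  by (simp add: left_D_def coeff_map_poly q_pderiv_0)

lemma normal_op_left_D: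
  assumes "q \<noteq> 0"
  shows "normal_op q (left_D q c) = D_op q * normal_op q c"
proof (induction c)
  case 0
  show ?case by (simp add: left_D_def normal_op_0)
next
  case (pCons p c)
  have "left_D q (pCons p c) = pCons (q_pderiv q p) ([:q_dilate q p:] + left_D q c)"
    by (simp add: left_D_def map_poly_pCons q_pderiv_0)
  then have "normal_op q (left_D q (pCons p c))
      = poly_end (q_pderiv q p) M_op + (poly_end (q_dilate q p) M_op + D_op q * normal_op q c) * D_op q"
    using normal_op_pCons[of q "q_dilate q p" 0]
    by (simp add: normal_op_pCons normal_op_add pCons.IH normal_op_0)
  also have "\<dots> = D_op q * normal_op q (pCons p c)"
    by (simp add: normal_op_pCons distrib_left distrib_right D_op_poly_end[OF assms] mult.assoc)
  finally show ?case .
qed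

lemma normal_op_left_D_funpow:
  "q \<noteq> 0 \<Longrightarrow> normal_op q ((left_D q ^^ k) c) = D_op q ^ k * normal_op q c"
  by (induction k) (simp_all add: normal_op_left_D mult.assoc)

lemma degree_left_D_funpow: "degree c \<le> d \<Longrightarrow> degree ((left_D q ^^ k) c) \<le> d + k"
proof (induction k)
  case (Suc k)
  then have *: "degree ((left_D q ^^ k) c) \<le> d + k" by simp
  show ?case
    using * by (intro degree_le)
      (auto simp: coeff_left_D coeff_pCons coeff_map_poly coeff_eq_0 q_pderiv_0 split: nat.splits)
qed simp

text \<open>Only the dilation raises the order in \<open>D\<close>, so the q-derivative never
  reaches the top coefficient.\<close>

lemma coeff_left_D_funpow_top:
  "degree c \<le> d \<Longrightarrow> coeff ((left_D q ^^ k) c) (d + k) = q_dilate (q ^ k) (coeff c d)"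
proof (induction k)
  case 0
  show ?case by (simp add: poly_eq_iff coeff_pcompose_linear)
next
  case (Suc k)
  have "coeff ((left_D q ^^ k) c) (Suc (d + k)) = 0"
    using degree_left_D_funpow[OF Suc.prems, of k q] by (intro coeff_eq_0) simp
  then show ?case
    using Suc.IH[OF Suc.prems]
    by (simp add: coeff_left_D q_pderiv_0 coeff_map_poly)
      (simp add: poly_eq_iff coeff_pcompose_linear power_mult_distrib mult_ac)
qed

text \<open>For \<open>q = 1\<close> the top coefficients of a product do not depend on the order of the factors,
  so the next coefficient is needed. The shift by \<open>pCons 0\<close> avoids the index \<open>d + k - 1\<close>.\<close>

lemma coeff_left_D_funpow_subtop:
  "degree c \<le> d \<Longrightarrow> coeff (pCons 0 ((left_D 1 ^^ k) c)) (d + k)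
    = coeff (pCons 0 c) d + of_nat k * q_pderiv 1 (coeff c d)"
proof (induction k)
  case (Suc k)
  have dil: "q_dilate 1 p = p" for p :: "'a poly"
    by (simp add: poly_eq_iff coeff_pcompose_linear)
  have map: "map_poly (q_dilate 1) x = x" for x :: "'a poly poly"
    by (simp add: poly_eq_iff coeff_map_poly dil)
  show ?case
    using Suc.IH[OF Suc.prems] coeff_left_D_funpow_top[OF Suc.prems, of k 1]
    by (simp add: coeff_left_D map dil algebra_simps)
qed simp

text \<open>Neither dilation nor q-derivative raises the degree in \<open>X\<close>. This is the
  source of the bound \<open>s\<close>.\<close>

lemma degree_coeff_left_D_funpow:
  "(\<And>j. degree (coeff c j) \<le> B) \<Longrightarrow> degree (coeff ((left_D q ^^ k) c) j) \<le> B"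
proof (induction k arbitrary: j)
  case (Suc k)
  have "degree (q_dilate q r) \<le> B" "degree (q_pderiv q r) \<le> B" if "degree r \<le> B" for r
    using that by (auto intro!: degree_le simp: coeff_pcompose_linear coeff_q_pderiv coeff_eq_0)
  then show ?case
    using Suc.IH[OF Suc.prems]
    by (auto intro!: degree_add_le simp: coeff_left_D coeff_pCons coeff_map_poly split: nat.splits)
qed simp

text \<open>The multiplication of the algebra transported to normal forms.\<close>

definition skew_mult :: "'a::field \<Rightarrow> 'a poly poly \<Rightarrow> 'a poly poly \<Rightarrow> 'a poly poly" where
  "skew_mult q p c = (\<Sum>j\<le>degree p. smult (coeff p j) ((left_D q ^^ j) c))"

lemma normal_op_skew_mult:
  assumes "q \<noteq> 0"
  shows "normal_op q (skew_mult q p c) = normal_op q p * normal_op q c"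
  unfolding skew_mult_def normal_op_sum normal_op_smult normal_op_left_D_funpow[OF assms]
  by (simp add: normal_op_def normal_form_def sum_distrib_right mult.assoc)

lemma q_heisenberg_normal_op:
  assumes "q \<noteq> 0" and "T \<in> q_heisenberg q"
  shows "\<exists>c. T = normal_op q c"
  using assms(2)
proof induction
  case (scalar a)
  have "scalar_end a = normal_op q [:[:a:]:]"
    by (simp add: normal_op_pCons normal_op_0 poly_end_const)
  then show ?case ..
next
  case D
  have "D_op q = normal_op q [:0, 1:]"
    by (simp add: normal_op_pCons normal_op_0 poly_end_1 poly_end_0)
  then show ?case ..
next
  case M
  have "M_op = normal_op q [:[:0, 1:]:]"
    by (simp add: normal_op_pCons normal_op_0 poly_end_X)
  then show ?case ..
next
  case (add S T)
  then show ?case by (metis normal_op_add)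
next
  case (mult S T)
  then show ?case by (metis normal_op_skew_mult[OF assms(1)])
qed

section \<open>Operators commuting with an operator of positive order\<close>

lemma coeff_skew_mult_top:
  "coeff (skew_mult q p c) (degree p + degree c)
    = lead_coeff p * q_dilate (q ^ degree p) (lead_coeff c)"
proof -
  have "coeff ((left_D q ^^ j) c) (degree p + degree c) = 0" if "j < degree p" for j
    using degree_left_D_funpow[of c "degree c" j q] that by (intro coeff_eq_0) simp
  then have "coeff (skew_mult q p c) (degree p + degree c)
      = coeff p (degree p) * coeff ((left_D q ^^ degree p) c) (degree p + degree c)"
    by (simp add: skew_mult_def coeff_sum sum.remove[of "{..degree p}" "degree p"])
  also have "\<dots> = lead_coeff p * q_dilate (q ^ degree p) (lead_coeff c)"
    using coeff_left_D_funpow_top[of c "degree c" "degree p" q] by (simp add: add.commute)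
  finally show ?thesis .
qed

text \<open>Only the two highest powers of \<open>D\<close> in \<open>p\<close> contribute: the
  first through the second highest coefficient it produces, the other through its top coefficient,
  which is unchanged as \<open>q = 1\<close>.\<close>

lemma coeff_skew_mult_subtop:
  fixes p c :: "'a::field poly poly"
  shows "coeff (pCons 0 (skew_mult 1 p c)) (degree p + degree c)
    = lead_coeff p * (coeff (pCons 0 c) (degree c) + of_nat (degree p) * q_pderiv 1 (lead_coeff c))
      + coeff (pCons 0 p) (degree p) * lead_coeff c"
proof -
  let ?t = "\<lambda>j. coeff p j * coeff (pCons 0 ((left_D 1 ^^ j) c)) (degree p + degree c)"
  have shift: "coeff (pCons 0 (skew_mult 1 p c)) k
      = (\<Sum>j\<le>degree p. coeff p j * coeff (pCons 0 ((left_D 1 ^^ j) c)) k)" for k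
    by (cases k) (simp_all add: skew_mult_def coeff_sum)
  have top: "?t (degree p) = lead_coeff p
      * (coeff (pCons 0 c) (degree c) + of_nat (degree p) * q_pderiv 1 (lead_coeff c))"
    using coeff_left_D_funpow_subtop[of c "degree c" "degree p"] by (simp add: add.commute)
  show ?thesis
  proof (cases "degree p")
    case 0
    then show ?thesis using top shift by simp
  next
    case (Suc m)
    have "coeff ((left_D 1 ^^ j) c) (m + degree c) = 0" if "j < m" for j
      using degree_left_D_funpow[of c "degree c" j 1] that by (intro coeff_eq_0) simp
    moreover have "coeff ((left_D 1 ^^ m) c) (m + degree c) = lead_coeff c"
      using coeff_left_D_funpow_top[of c "degree c" m 1]
      by (simp add: add.commute poly_eq_iff coeff_pcompose_linear)
    ultimately have "(\<Sum>j\<le>m. ?t j) = coeff p m * lead_coeff c"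
      by (simp add: Suc sum.remove[of "{..m}" m])
    then show ?thesis using top shift[of "degree p + degree c"] Suc by auto
  qed
qed

text \<open>Upper bounds suffice, so the coefficients at \<open>i\<close> and \<open>j\<close> may
  vanish; this is needed when a derivative lowers the degree.\<close>

lemma coeff_mult_add_degree_le:
  fixes a b :: "'a::comm_semiring_0 poly"
  assumes "degree a \<le> i" "degree b \<le> j"
  shows "coeff (a * b) (i + j) = coeff a i * coeff b j"
proof (cases "degree a = i \<and> degree b = j")
  case True
  then show ?thesis using coeff_mult_degree_sum[of a b] by auto
next
  case False
  then have "degree (a * b) < i + j"
    using assms degree_mult_le[of a b] by linarith
  then show ?thesis
    using False assms by (auto simp: coeff_eq_0)
qed

text \<open>For \<open>q \<noteq> 1\<close> the top coefficients of both products give an equality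
  of powers of \<open>q\<close>, and \<open>q\<close> is not a root of unity. For
  \<open>q = 1\<close> the second highest ones give
  \<open>degree p * a * b' = degree c * b * a'\<close>, and the characteristic is zero.\<close>

lemma degree_lead_coeff_commuting:
  assumes q: "q \<noteq> 0" "\<forall>k. q_int q k = 0 \<longleftrightarrow> k = 0"
    and comm: "normal_op q p * normal_op q c = normal_op q c * normal_op q p"
    and nz: "p \<noteq> 0" "c \<noteq> 0"
  shows "degree p * degree (lead_coeff c) = degree c * degree (lead_coeff p)"
proof -
  define a b where "a = lead_coeff p" and "b = lead_coeff c"
  have ab: "a \<noteq> 0" "b \<noteq> 0" using nz by (simp_all add: a_def b_def)
  have skew: "skew_mult q p c = skew_mult q c p"
    using comm by (simp add: normal_op_skew_mult[OF q(1)] flip: normal_op_inject[OF q(2)])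
  show ?thesis
  proof (cases "q = 1")
    case False
    have lead: "lead_coeff (q_dilate (q ^ k) r) = q ^ (k * degree r) * lead_coeff r" for k r
      using q(1) by (simp add: coeff_pcompose_linear degree_pcompose power_mult)
    have "a * q_dilate (q ^ degree p) b = b * q_dilate (q ^ degree c) a"
      using coeff_skew_mult_top[of q p c] coeff_skew_mult_top[of q c p]
      by (simp add: skew a_def b_def add.commute)
    then have "lead_coeff a * (q ^ (degree p * degree b) * lead_coeff b)
        = lead_coeff b * (q ^ (degree c * degree a) * lead_coeff a)"
      by (metis lead lead_coeff_mult)
    then have "q ^ (degree p * degree b) = q ^ (degree c * degree a)"
      using ab by simp
    \<comment> \<open>An integer exponent, since the sign of the difference is not known.\<close>
    then have "q powi (int (degree p * degree b) - int (degree c * degree a)) = 1"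
      using q(1) by (simp add: power_int_diff del: of_nat_mult)
    then have "q_int q (int (degree p * degree b) - int (degree c * degree a)) = 0"
      by (simp add: q_int_def False)
    then show ?thesis
      using q(2) by (simp add: a_def b_def del: of_nat_mult)
  next
    case True
    \<comment> \<open>The Euler operator \<open>X d/dX\<close>. It multiplies the coefficient at
      \<open>i\<close> by \<open>i\<close>, so degrees can be compared without subtracting
      1.\<close>
    let ?\<theta> = "\<lambda>r::'a poly. pCons 0 (q_pderiv 1 r)"
    have \<theta>: "coeff (?\<theta> r) i = of_nat i * coeff r i" for r i
      by (cases i) (simp_all add: coeff_q_pderiv q_int_def)
    have deg: "degree (?\<theta> r) \<le> degree r" for r
      by (rule degree_le) (metis \<theta> coeff_eq_0 mult_zero_right)
    \<comment> \<open>The products of leading with second highest coefficients occur on both sides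
      and cancel.\<close>
    have "of_nat (degree p) * (a * q_pderiv 1 b) = of_nat (degree c) * (b * q_pderiv 1 a)"
      using coeff_skew_mult_subtop[of p c] coeff_skew_mult_subtop[of c p] skew True
      by (simp add: a_def b_def add.commute algebra_simps)
    then have "smult (of_nat (degree p)) (a * ?\<theta> b) = smult (of_nat (degree c)) (b * ?\<theta> a)"
      by (simp add: of_nat_poly)
    then have "coeff (smult (of_nat (degree p)) (a * ?\<theta> b)) (degree a + degree b)
        = coeff (smult (of_nat (degree c)) (b * ?\<theta> a)) (degree b + degree a)"
      by (simp add: add.commute)
    then have "of_nat (degree p) * (lead_coeff a * (of_nat (degree b) * lead_coeff b))
        = of_nat (degree c) * (lead_coeff b * (of_nat (degree a) * lead_coeff a))"
      by (simp only: coeff_smult coeff_mult_add_degree_le[OF order_refl deg] \<theta>)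
    then have "(of_nat (degree p * degree b) :: 'a) = of_nat (degree c * degree a)"
      using ab by simp
    then have "q_int q (int (degree p * degree b) - int (degree c * degree a)) = 0"
      by (simp add: q_int_def True)
    then show ?thesis
      using q(2) by (simp add: a_def b_def del: of_nat_mult)
  qed
qed

text \<open>All nonzero \<open>c i\<close> of maximal order have leading coefficients of the same degree \<open>e\<close>, so
  those of the summands \<open>M^i * normal_op q (c i)\<close> have the distinct degrees \<open>i + e\<close> and cannot
  cancel.\<close>

lemma M_powers_independent_over_commutant:
  assumes q: "q \<noteq> 0" "\<forall>k. q_int q k = 0 \<longleftrightarrow> k = 0"
    and p: "degree p > 0"
    and comm: "\<And>i. i \<le> s \<Longrightarrow> normal_op q p * normal_op q (c i) = normal_op q (c i) * normal_op q p"
    and sum: "(\<Sum>i\<le>s. M_op ^ i * normal_op q (c i)) = 0"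
    and i: "i \<le> s"
  shows "c i = 0"
proof (rule ccontr)
  assume nz: "c i \<noteq> 0"
  define I where "I = {i. i \<le> s \<and> c i \<noteq> 0}"
  have I: "finite I" "I \<noteq> {}" using i nz by (auto simp: I_def)
  \<comment> \<open>\<open>d\<close> is the highest order that occurs, \<open>J\<close> the set of
    indices attaining it and \<open>k\<close> the largest of these. The coefficient at
    \<open>X^(k+e) D^d\<close> then sees the summand \<open>k\<close> alone.\<close>
  define d where "d = Max ((\<lambda>i. degree (c i)) ` I)"
  define J where "J = {i \<in> I. degree (c i) = d}"
  have "d \<in> (\<lambda>i. degree (c i)) ` I" unfolding d_def using I by (intro Max_in) auto
  then have J: "finite J" "J \<noteq> {}" using I by (auto simp: J_def)
  define k where "k = Max J"
  have k: "k \<in> J" unfolding k_def using J by (rule Max_in)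
  have le_d: "degree (c j) \<le> d" if "j \<in> I" for j
    unfolding d_def using I that by (intro Max_ge) auto
  have le_k: "j \<le> k" if "j \<in> J" for j
    unfolding k_def using J that by (intro Max_ge) auto
  define e where "e = degree (coeff (c k) d)"
  have "p \<noteq> 0" using p by auto
  then have lead: "degree p * degree (coeff (c j) d) = d * degree (lead_coeff p)" if "j \<in> J" for j
    using degree_lead_coeff_commuting[OF q comm, of j] that by (auto simp: I_def J_def)
  have e: "degree (coeff (c j) d) = e" if "j \<in> J" for j
    using trans[OF lead[OF that] lead[OF k, symmetric]] p by (simp add: e_def)
  have "normal_op q (\<Sum>j\<le>s. smult (monom 1 j) (c j)) = 0"
    using sum by (simp add: normal_op_sum normal_op_smult poly_end_X_power)
  then have "(\<Sum>j\<le>s. smult (monom 1 j) (c j)) = 0"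
    by (rule normal_op_eq_0[OF q(2)])
  then have "coeff (coeff (\<Sum>j\<le>s. smult (monom 1 j) (c j)) d) (k + e) = 0"
    by simp
  then have "0 = (\<Sum>j\<le>s. coeff (monom 1 j * coeff (c j) d) (k + e))"
    by (simp add: coeff_sum)
  also have "\<dots> = (\<Sum>j\<le>s. if j = k then lead_coeff (coeff (c k) d) else 0)"
  proof (rule sum.cong[OF refl])
    fix j assume "j \<in> {..s}"
    consider "c j = 0" | "j \<in> I" "j \<notin> J" | "j \<in> J"
      using \<open>j \<in> {..s}\<close> by (auto simp: I_def)
    then show "coeff (monom 1 j * coeff (c j) d) (k + e)
        = (if j = k then lead_coeff (coeff (c k) d) else 0)"
    proof cases
      case 1
      then show ?thesis using k by (auto simp: J_def I_def)
    next
      case 2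
      then have "degree (c j) < d" using le_d[of j] by (auto simp: J_def)
      then show ?thesis using 2 k by (auto simp: coeff_eq_0)
    next
      case 3
      show ?thesis
      proof (cases "j = k")
        case True
        then show ?thesis by (simp add: coeff_monom_mult e_def)
      next
        case False
        then have "j < k" using le_k[OF 3] by simp
        then show ?thesis
          using e[OF 3] by (simp add: coeff_monom_mult coeff_eq_0)
      qed
    qed
  qed
  also have "\<dots> = lead_coeff (coeff (c k) d)"
    using k by (simp add: J_def I_def)
  finally have "coeff (c k) d = 0" by simp
  then show False using k by (auto simp: J_def I_def)
qed

section \<open>Determinants of polynomial matrices\<close>

lemma coeff_prod_degree_le:
  fixes f :: "'i \<Rightarrow> 'b::comm_semiring_1 poly"
  assumes "finite I" and "\<And>i. i \<in> I \<Longrightarrow> degree (f i) \<le> r i"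
  shows "degree (prod f I) \<le> sum r I \<and> coeff (prod f I) (sum r I) = (\<Prod>i\<in>I. coeff (f i) (r i))"
  using assms
proof (induction I rule: finite_induct)
  case (insert i I)
  then have i: "degree (f i) \<le> r i" and I: "degree (prod f I) \<le> sum r I"
    "coeff (prod f I) (sum r I) = (\<Prod>i\<in>I. coeff (f i) (r i))" by auto
  have "degree (f i * prod f I) \<le> r i + sum r I"
    using degree_mult_le[of "f i" "prod f I"] i I(1) by linarith
  then show ?case
    using coeff_mult_add_degree_le[OF i I(1)] I(2) insert.hyps by simp
qed simp

text \<open>Each product in the Leibniz formula takes one entry from every row, so the row bounds
  add up, and the coefficient at their sum is formed entrywise. This serves all three
  variables.\<close>

lemma coeff_det_row_degrees:
  fixes A :: "'b::comm_ring_1 poly mat"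
  assumes A: "A \<in> carrier_mat N N"
    and deg: "\<And>i j. i < N \<Longrightarrow> j < N \<Longrightarrow> degree (A $$ (i, j)) \<le> r i"
  shows "degree (det A) \<le> sum r {..<N}"
    and "coeff (det A) (sum r {..<N}) = det (mat N N (\<lambda>(i, j). coeff (A $$ (i, j)) (r i)))"
proof -
  have sgn: "coeff (signof \<pi> * x) k = signof \<pi> * coeff x k" for \<pi> :: "nat \<Rightarrow> nat" and x :: "'b poly" and k
    by (simp add: sign_def)
  have lt: "\<pi> i < N" if "\<pi> permutes {0..<N}" "i < N" for \<pi> i
    using permutes_in_image[OF that(1), of i] that(2) by simp
  have prod: "degree (\<Prod>i<N. A $$ (i, \<pi> i)) \<le> sum r {..<N}"
    "coeff (\<Prod>i<N. A $$ (i, \<pi> i)) (sum r {..<N}) = (\<Prod>i<N. coeff (A $$ (i, \<pi> i)) (r i))"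
    if "\<pi> permutes {0..<N}" for \<pi>
    using coeff_prod_degree_le[of "{..<N}" "\<lambda>i. A $$ (i, \<pi> i)" r] deg lt[OF that] by auto
  show "degree (det A) \<le> sum r {..<N}"
  proof (intro degree_le allI impI)
    fix k assume "sum r {..<N} < k"
    then have "coeff (\<Prod>i<N. A $$ (i, \<pi> i)) k = 0" if "\<pi> permutes {0..<N}" for \<pi>
      using prod(1)[OF that] by (intro coeff_eq_0) simp
    then show "coeff (det A) k = 0"
      by (simp add: det_def'[OF A] coeff_sum sgn atLeast0LessThan)
  qed
  show "coeff (det A) (sum r {..<N}) = det (mat N N (\<lambda>(i, j). coeff (A $$ (i, j)) (r i)))"
    by (subst det_def'[of _ N])
      (auto simp: det_def'[OF A] coeff_sum sgn atLeast0LessThan prod(2) lt intro!: sum.cong prod.cong)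
qed

lemma prod_lessThan_add:
  "(\<Prod>i<m + n. f i) = (\<Prod>i<m. f i) * (\<Prod>i<n. f (m + i))" for f :: "nat \<Rightarrow> 'b::comm_monoid_mult"
  by (induction n) (simp_all add: mult.assoc)

lemma const_poly_prod: "(\<Prod>i\<in>I. [:f i:]) = [:\<Prod>i\<in>I. f i:]"
  by (induction I rule: infinite_finite_induct) (simp_all add: one_pCons mult.commute)

lemma det_lower_triangular_split:
  assumes "A \<in> carrier_mat (m + n) (m + n)"
    and "\<And>i j. i < j \<Longrightarrow> j < m + n \<Longrightarrow> A $$ (i, j) = 0"
  shows "det A = (\<Prod>i<m. A $$ (i, i)) * (\<Prod>i<n. A $$ (m + i, m + i))"
  using det_lower_triangular[OF assms(2,1)] assms(1)
  by (simp add: prod_list_diag_prod atLeast0LessThan prod_lessThan_add)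

text \<open>Ring homomorphisms commute with determinants, so the variables of the eliminant can be
  reordered inside the matrix.\<close>

lemma poly_swap_comm_ring_hom: "comm_ring_hom (poly_swap :: 'b::comm_ring_1 poly poly \<Rightarrow> _)"
proof
  show "poly_swap (p + r) = poly_swap p + poly_swap r" for p r :: "'b poly poly"
    by (intro poly_eqI) (simp add: coeff_poly_swap)
  show "poly_swap (p * r) = poly_swap p * poly_swap r" for p r :: "'b poly poly"
  proof (intro poly_eqI)
    fix i j
    have "coeff (coeff (poly_swap (p * r)) i) j
        = (\<Sum>j'\<le>j. \<Sum>i'\<le>i. coeff (coeff p j') i' * coeff (coeff r (j - j')) (i - i'))"
      by (simp add: coeff_poly_swap coeff_mult coeff_sum)
    also have "\<dots> = (\<Sum>i'\<le>i. \<Sum>j'\<le>j. coeff (coeff p j') i' * coeff (coeff r (j - j')) (i - i'))"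
      by (rule sum.swap)
    also have "\<dots> = coeff (coeff (poly_swap p * poly_swap r) i) j"
      by (simp add: coeff_poly_swap coeff_mult coeff_sum)
    finally show "coeff (coeff (poly_swap (p * r)) i) j = coeff (coeff (poly_swap p * poly_swap r) i) j" .
  qed
  show "poly_swap 1 = (1 :: 'b poly poly)"
    by (intro poly_eqI) (simp add: coeff_poly_swap coeff_pCons one_pCons split: nat.splits)
  show "poly_swap 0 = (0 :: 'b poly poly)"
    by (intro poly_eqI) (simp add: coeff_poly_swap)
qed

lemma as_poly_in_X_comm_ring_hom: "comm_ring_hom (as_poly_in_X :: 'a::field poly poly poly \<Rightarrow> _)"
proof -
  interpret swap: comm_ring_hom "poly_swap :: 'b::comm_ring_1 poly poly \<Rightarrow> _"
    by (rule poly_swap_comm_ring_hom)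
  have map: "map_poly poly_swap (x + y) = map_poly poly_swap x + map_poly poly_swap y"
    "map_poly poly_swap (x * y) = map_poly poly_swap x * map_poly poly_swap y"
    for x y :: "'a poly poly poly"
    by (intro poly_eqI; simp add: coeff_map_poly coeff_mult hom_distribs)+
  show ?thesis
    by standard (simp_all add: as_poly_in_X_def map hom_distribs)
qed

section \<open>Subrings\<close>

definition subring_set :: "'b::comm_ring_1 set \<Rightarrow> bool" where
  "subring_set S \<longleftrightarrow> 1 \<in> S \<and> (\<forall>x\<in>S. \<forall>y\<in>S. x - y \<in> S) \<and> (\<forall>x\<in>S. \<forall>y\<in>S. x * y \<in> S)"

context
  fixes S :: "'b::comm_ring_1 set"
  assumes S: "subring_set S"
begin

lemma subring_set_one: "1 \<in> S"
  and subring_set_diff: "x \<in> S \<Longrightarrow> y \<in> S \<Longrightarrow> x - y \<in> S"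
  and subring_set_mult: "x \<in> S \<Longrightarrow> y \<in> S \<Longrightarrow> x * y \<in> S"
  using S by (auto simp: subring_set_def)

lemma subring_set_zero: "0 \<in> S"
  using subring_set_diff[OF subring_set_one subring_set_one] by simp

lemma subring_set_uminus: "x \<in> S \<Longrightarrow> - x \<in> S"
  using subring_set_diff[OF subring_set_zero] by simp

lemma subring_set_add: "x \<in> S \<Longrightarrow> y \<in> S \<Longrightarrow> x + y \<in> S"
  using subring_set_diff[OF _ subring_set_uminus, of x y] by simp

lemma subring_set_sum: "(\<And>i. i \<in> I \<Longrightarrow> f i \<in> S) \<Longrightarrow> sum f I \<in> S"
  by (induction I rule: infinite_finite_induct) (simp_all add: subring_set_zero subring_set_add)

lemma subring_set_prod: "(\<And>i. i \<in> I \<Longrightarrow> f i \<in> S) \<Longrightarrow> prod f I \<in> S"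
  by (induction I rule: infinite_finite_induct) (simp_all add: subring_set_one subring_set_mult)

text \<open>Applied three times, this handles polynomials in three variables with coefficients in
  \<open>S\<close>.\<close>

lemma subring_set_coeffs: "subring_set {p. \<forall>i. coeff p i \<in> S}"
  unfolding subring_set_def
  by (auto simp: coeff_mult one_pCons coeff_pCons split: nat.splits
      intro!: subring_set_sum subring_set_mult subring_set_diff subring_set_one subring_set_zero)

lemma subring_set_det:
  assumes "A \<in> carrier_mat N N" "\<And>i j. i < N \<Longrightarrow> j < N \<Longrightarrow> A $$ (i, j) \<in> S"
  shows "det A \<in> S"
proof -
  have "signof \<pi> \<in> S" for \<pi> :: "nat \<Rightarrow> nat"
    by (simp add: sign_def subring_set_one subring_set_uminus)
  moreover have "\<pi> i < N" if "\<pi> permutes {0..<N}" "i < N" for \<pi> i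
    using permutes_in_image[OF that(1), of i] that(2) by simp
  ultimately show ?thesis
    unfolding det_def'[OF assms(1)]
    by (auto intro!: subring_set_sum subring_set_mult subring_set_prod assms(2))
qed

end

lemma subring_set_gen_subring: "subring_set (gen_subring T)"
  unfolding subring_set_def gen_subring_def by blast

lemma gen_subring_superset: "T \<subseteq> gen_subring T"
  unfolding gen_subring_def by blast

section \<open>The commuting operators satisfy the coefficients of the eliminant\<close>

lemma q_heisenberg_zero: "0 \<in> q_heisenberg q"
  using q_heisenberg.scalar[of 0 q] by (simp add: scalar_end_hom)

lemma q_heisenberg_one: "1 \<in> q_heisenberg q"
  using q_heisenberg.scalar[of 1 q] by (simp add: scalar_end_hom)

lemma q_heisenberg_power: "T \<in> q_heisenberg q \<Longrightarrow> T ^ k \<in> q_heisenberg q"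
  by (induction k) (simp_all add: q_heisenberg_one q_heisenberg.mult)

lemma q_heisenberg_sum: "(\<And>i. i \<in> I \<Longrightarrow> f i \<in> q_heisenberg q) \<Longrightarrow> sum f I \<in> q_heisenberg q"
  by (induction I rule: infinite_finite_induct) (simp_all add: q_heisenberg_zero q_heisenberg.add)

lemma q_heisenberg_poly2_end:
  assumes "P \<in> q_heisenberg q" "Q \<in> q_heisenberg q"
  shows "poly2_end \<delta> P Q \<in> q_heisenberg q"
  unfolding poly2_end_def poly_end_def
  by (intro q_heisenberg_sum q_heisenberg.mult q_heisenberg_power q_heisenberg.scalar assms)

lemma poly_end_commute: "U * T = T * U \<Longrightarrow> U * poly_end p T = poly_end p T * U"
  by (induction p)
    (simp_all add: poly_end_0 poly_end_pCons distrib_left distrib_right scalar_end_commute,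
     metis mult.assoc)

lemma poly2_end_commute:
  assumes "U * P = P * U" "U * Q = Q * U"
  shows "U * poly2_end \<delta> P Q = poly2_end \<delta> P Q * U"
proof -
  have "U * (poly_end r P * Q ^ b) = poly_end r P * Q ^ b * U" for r b
    using poly_end_commute[OF assms(1)] power_commuting_commutes[OF assms(2)[symmetric], of b]
    by (metis mult.assoc)
  then show ?thesis
    by (simp add: poly2_end_def sum_distrib_left sum_distrib_right)
qed

text \<open>In the module structure below, \<open>X\<close> acts as left multiplication by \<open>M\<close>, whereas \<open>\<lambda>\<close> and
  \<open>\<mu>\<close> act as right multiplication by \<open>P\<close> and \<open>Q\<close>. These actions commute although the operators
  \<open>M\<close> and \<open>P\<close> do not.\<close>

abbreviation lambda_scale ::
    "'a::field laurent_end \<Rightarrow> 'a poly poly \<Rightarrow> 'a laurent_end \<Rightarrow> 'a laurent_end" where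
  "lambda_scale P \<equiv> poly_scale M_scale (\<lambda>v. v * P)"

abbreviation lambda_mu_scale ::
    "'a::field laurent_end \<Rightarrow> 'a laurent_end \<Rightarrow> 'a poly poly poly \<Rightarrow> 'a laurent_end \<Rightarrow> 'a laurent_end"
  where "lambda_mu_scale P Q \<equiv> poly_scale (lambda_scale P) (\<lambda>v. v * Q)"

text \<open>Here the commutation of \<open>P\<close> and \<open>Q\<close> enters: it makes the
  actions of \<lambda> and \<mu> commute.\<close>

lemma module_endo_lambda_scale:
  assumes "P * Q = Q * P"
  shows "module_endo (lambda_scale P) (\<lambda>v. v * Q)"
  by (rule module_endo.module_endo_poly_scale[OF module_endo_right_mult])
    (simp_all add: distrib_right mult.assoc assms)

text \<open>A common bound for all three exponents lets the triple sum be reordered freely.\<close>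

lemma trivariate_coeff_bound:
  fixes p :: "'b::zero poly poly poly"
  shows "\<exists>N. \<forall>b a i. N < b \<or> N < a \<or> N < i \<longrightarrow> coeff (coeff (coeff p b) a) i = 0"
proof -
  define N1 where "N1 = Max ((\<lambda>b. degree (coeff p b)) ` {..degree p})"
  define N2 where "N2 = Max ((\<lambda>(b, a). degree (coeff (coeff p b) a)) ` ({..degree p} \<times> {..N1}))"
  have N1: "degree (coeff p b) \<le> N1" if "b \<le> degree p" for b
    unfolding N1_def using that by (intro Max_ge) auto
  have N2: "degree (coeff (coeff p b) a) \<le> N2" if "b \<le> degree p" "a \<le> N1" for a b
    unfolding N2_def using that by (intro Max_ge) force+
  have "coeff (coeff (coeff p b) a) i = 0"
    if "degree p < b \<or> N1 < a \<or> N2 < i" for b a i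
  proof (cases "b \<le> degree p \<and> a \<le> N1")
    case True
    then have "N2 < i" using that by auto
    then show ?thesis using N2[of b a] True by (intro coeff_eq_0) simp
  next
    case False
    then show ?thesis
    proof (cases "b \<le> degree p")
      case True
      then show ?thesis using False N1[of b] by (simp add: coeff_eq_0)
    qed (simp add: coeff_eq_0)
  qed
  then show ?thesis by (intro exI[of _ "degree p + N1 + N2"]) auto
qed

text \<open>A monomial in \<open>X\<close>, \<lambda>, \<mu> sends \<open>1\<close> to
  \<open>M_op ^ i * Q ^ b * P ^ a\<close>, as the action of \<mu> is applied first. Commuting the
  last two factors and collecting powers of \<open>M_op\<close> gives the right-hand side.\<close>

lemma lambda_mu_scale_one:
  assumes comm: "P * Q = Q * P"
    and s: "degree (as_poly_in_X \<Delta>) \<le> s"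
  shows "lambda_mu_scale P Q \<Delta> 1
    = (\<Sum>i\<le>s. M_op ^ i * poly2_end (coeff (as_poly_in_X \<Delta>) i) P Q)"
proof -
  interpret S2: module_endo "lambda_scale P" "\<lambda>v. v * Q"
    by (rule module_endo_lambda_scale[OF comm])
  interpret S1: module_endo M_scale "\<lambda>v. v * P"
    by (rule module_endo_right_mult)
  obtain N0 where N0: "\<And>b a i. N0 < b \<or> N0 < a \<or> N0 < i \<Longrightarrow> coeff (coeff (coeff \<Delta> b) a) i = 0"
    using trivariate_coeff_bound[of \<Delta>] by blast
  define N where "N = N0 + s"
  have N: "coeff (coeff (coeff \<Delta> b) a) i = 0" if "N < b \<or> N < a \<or> N < i" for b a i
    using that by (intro N0) (auto simp: N_def)
  have deg: "degree \<Delta> \<le> N" "degree (coeff \<Delta> b) \<le> N" "degree (coeff (coeff \<Delta> b) a) \<le> N"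
    "degree (coeff (as_poly_in_X \<Delta>) i) \<le> N" "degree (coeff (coeff (as_poly_in_X \<Delta>) i) b) \<le> N"
    for a b i
    by (auto intro!: degree_le poly_eqI simp: coeff_as_poly_in_X N)
  have PQ: "P ^ a * Q ^ b = Q ^ b * P ^ a" for a b
    by (metis comm power_commuting_commutes)
  let ?c = "\<lambda>b a i. scalar_end (coeff (coeff (coeff \<Delta> b) a) i)"
  have upto: "poly2_end \<delta> P Q = (\<Sum>b\<le>N. poly_end (coeff \<delta> b) P * Q ^ b)" if "degree \<delta> \<le> N" for \<delta>
    unfolding poly2_end_def using that
    by (intro sum.mono_neutral_left) (auto simp: coeff_eq_0 poly_end_0)
  have zero: "poly2_end 0 P Q = 0"
    by (simp add: poly2_end_def poly_end_0)
  have "lambda_mu_scale P Q \<Delta> 1 = (\<Sum>b\<le>N. \<Sum>a\<le>N. \<Sum>i\<le>N. ?c b a i * M_op ^ i * (Q ^ b * P ^ a))"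
    by (simp add: S2.poly_scale_upto[OF deg(1)] S1.poly_scale_upto[OF deg(2)] right_mult_funpow
        poly_end_upto[OF deg(3)] sum_distrib_right)
  also have "\<dots> = (\<Sum>i\<le>N. \<Sum>b\<le>N. \<Sum>a\<le>N. M_op ^ i * (?c b a i * P ^ a * Q ^ b))"
  proof -
    have "(\<Sum>b\<le>N. \<Sum>a\<le>N. \<Sum>i\<le>N. ?c b a i * M_op ^ i * (Q ^ b * P ^ a))
        = (\<Sum>b\<le>N. \<Sum>a\<le>N. \<Sum>i\<le>N. M_op ^ i * (?c b a i * P ^ a * Q ^ b))"
      by (intro sum.cong refl) (simp add: mult.assoc PQ scalar_end_left_commute[of "M_op ^ _"])
    also have "\<dots> = (\<Sum>b\<le>N. \<Sum>i\<le>N. \<Sum>a\<le>N. M_op ^ i * (?c b a i * P ^ a * Q ^ b))"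
      by (intro sum.cong refl sum.swap)
    also have "\<dots> = (\<Sum>i\<le>N. \<Sum>b\<le>N. \<Sum>a\<le>N. M_op ^ i * (?c b a i * P ^ a * Q ^ b))"
      by (rule sum.swap)
    finally show ?thesis .
  qed
  also have "\<dots> = (\<Sum>i\<le>N. M_op ^ i * poly2_end (coeff (as_poly_in_X \<Delta>) i) P Q)"
    by (simp add: upto[OF deg(4)] poly_end_upto[OF deg(5)] coeff_as_poly_in_X
        sum_distrib_left sum_distrib_right)
  also have "\<dots> = (\<Sum>i\<le>s. M_op ^ i * poly2_end (coeff (as_poly_in_X \<Delta>) i) P Q)"
    using s by (intro sum.mono_neutral_right) (auto simp: N_def coeff_eq_0 zero)
  finally show ?thesis .
qed

section \<open>The eliminant\<close>

lemma const_poly_neg_one_power: "[:(- 1) ^ k * x:] = (- 1) ^ k * [:x:]" for x :: "'b::comm_ring_1"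
  by (cases "even k") simp_all

locale heisenberg_pair =
  fixes q :: "'a::field" and m n :: nat and p r :: "'a poly poly"
  assumes q_nonzero: "q \<noteq> 0"
    and q_int_eq_0: "\<forall>k. q_int q k = 0 \<longleftrightarrow> k = 0"
    and m_pos: "0 < m" and n_pos: "0 < n"
    and degree_p: "degree p = m" and degree_r: "degree r = n"
begin

abbreviation "A \<equiv> eliminant_mat q m n (normal_op q p) (normal_op q r)"

abbreviation "\<Delta> \<equiv> eliminant q m n (normal_op q p) (normal_op q r)"

lemma carrier_A: "A \<in> carrier_mat (m + n) (m + n)"
  by (simp add: eliminant_mat_def Let_def)

lemma D_coeff_D_op_power:
  "D_coeff q (D_op q ^ k * normal_op q c) = coeff ((left_D q ^^ k) c)"
  by (simp add: normal_op_left_D_funpow[OF q_nonzero, symmetric] D_coeff_normal_op[OF q_int_eq_0])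

lemma A_upper:
  "i < n \<Longrightarrow> j < m + n \<Longrightarrow>
    A $$ (i, j) = [:[:coeff ((left_D q ^^ i) p) j:]:] - (if j = i then [:[:0, 1:]:] else 0)"
  by (simp add: eliminant_mat_def Let_def D_coeff_D_op_power)

lemma A_lower:
  "\<not> i < n \<Longrightarrow> i < m + n \<Longrightarrow> j < m + n \<Longrightarrow>
    A $$ (i, j) = [:[:coeff ((left_D q ^^ (i - n)) r) j:]:] - (if j = i - n then [:0, 1:] else 0)"
  by (simp add: eliminant_mat_def Let_def D_coeff_D_op_power)

lemma p_top: "coeff ((left_D q ^^ k) p) (m + k) = q_dilate (q ^ k) (coeff p m)"
  and r_top: "coeff ((left_D q ^^ k) r) (n + k) = q_dilate (q ^ k) (coeff r n)"
  using coeff_left_D_funpow_top[of p m] coeff_left_D_funpow_top[of r n] degree_p degree_r by auto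

lemma p_above: "m + k < j \<Longrightarrow> coeff ((left_D q ^^ k) p) j = 0"
  and r_above: "n + k < j \<Longrightarrow> coeff ((left_D q ^^ k) r) j = 0"
  using degree_left_D_funpow[of p m k q] degree_left_D_funpow[of r n k q] degree_p degree_r
  by (auto intro!: coeff_eq_0)

section \<open>Degrees and top coefficients of the eliminant\<close>

lemma sum_rows: "(\<Sum>i<m + n. if i < n then a else b) = n * a + m * b" for a b :: nat
proof -
  have "(\<Sum>i<n + m. if i < n then a else b) = n * a + m * b"
    by (induction m) simp_all
  then show ?thesis by (simp add: add.commute)
qed

text \<open>\<mu> occurs only in the last \<open>m\<close> rows, to degree at most 1. Taking its
  coefficient there leaves minus the identity followed by zeros; moving these rows to the top costs
  the sign \<open>(-1)^(m * n)\<close> and makes the matrix lower triangular.\<close>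

lemma degree_eliminant_mu: "degree \<Delta> \<le> m"
  and coeff_eliminant_mu:
    "coeff \<Delta> m = [:(- 1) ^ (m * (n + 1)) * (\<Prod>k<n. q_dilate (q ^ k) (coeff p m)):]"
proof -
  define B where "B = mat (m + n) (m + n) (\<lambda>(i, j). coeff (A $$ (i, j)) (if i < n then 0 else 1))"
  have deg: "degree (A $$ (i, j)) \<le> (if i < n then 0 else 1)" if "i < m + n" "j < m + n" for i j
    using that by (cases "i < n") (auto simp: A_upper A_lower intro!: degree_diff_le)
  note det = coeff_det_row_degrees[OF carrier_A deg, unfolded sum_rows]
  show "degree \<Delta> \<le> m" using det(1) by (simp add: eliminant_def)
  have "coeff \<Delta> m = det B"
    using det(2) by (simp add: eliminant_def B_def)
  also have "\<dots> = (- 1) ^ (m * n) * det (mat (m + n) (m + n)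
      (\<lambda>(i, j). B $$ (if i < m then i + n else i - m, j)))"
    by (rule det_swap_rows) (simp add: B_def)
  also have "det (mat (m + n) (m + n) (\<lambda>(i, j). B $$ (if i < m then i + n else i - m, j)))
      = (\<Prod>i<m. - 1) * (\<Prod>k<n. [:q_dilate (q ^ k) (coeff p m):])"
    \<comment> \<open>Since \<open>m > 0\<close>, the entries containing \<lambda> now lie strictly
      below the diagonal.\<close>
    using m_pos n_pos
    by (subst det_lower_triangular_split)
      (auto simp: B_def A_upper A_lower p_above p_top)
  also have "(- 1) ^ (m * n) * \<dots>
      = [:(- 1) ^ (m * (n + 1)) * (\<Prod>k<n. q_dilate (q ^ k) (coeff p m)):]"
    by (simp add: const_poly_prod const_poly_neg_one_power power_add mult_ac)
  finally show "coeff \<Delta> m = [:(- 1) ^ (m * (n + 1)) * (\<Prod>k<n. q_dilate (q ^ k) (coeff p m)):]" .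
qed

text \<open>\<lambda> occurs only in the first \<open>n\<close> rows, so the matrix of coefficients
  is lower triangular without moving rows. Since \<open>n > 0\<close>, the entries containing \<mu>
  are off the diagonal.\<close>

lemma degree_eliminant_lambda: "degree (as_poly_in_lambda \<Delta>) \<le> n"
  and coeff_eliminant_lambda: "coeff (as_poly_in_lambda \<Delta>) n
    = [:(- 1) ^ n * (\<Prod>k<m. q_dilate (q ^ k) (coeff r n)):]"
proof -
  interpret swap: comm_ring_hom "poly_swap :: 'a poly poly poly \<Rightarrow> _"
    by (rule poly_swap_comm_ring_hom)
  let ?A = "map_mat poly_swap A"
  have swap_simps: "poly_swap [:[:c:]:] = [:[:c:]:]" "poly_swap [:[:0, 1:]:] = [:0, 1:]"
    "poly_swap [:0, 1:] = [:[:0, 1:]:]" for c :: "'a poly"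
    by (intro poly_eqI; simp add: coeff_poly_swap coeff_pCons split: nat.splits)+
  have A: "?A $$ (i, j)
      = (if i < n then [:[:coeff ((left_D q ^^ i) p) j:]:] - (if j = i then [:0, 1:] else 0)
         else [:[:coeff ((left_D q ^^ (i - n)) r) j:]:] - (if j = i - n then [:[:0, 1:]:] else 0))"
    if "i < m + n" "j < m + n" for i j
    using that carrier_A by (auto simp: A_upper A_lower swap.hom_minus swap_simps)
  define B where "B = mat (m + n) (m + n) (\<lambda>(i, j). coeff (?A $$ (i, j)) (if i < n then 1 else 0))"
  have deg: "degree (?A $$ (i, j)) \<le> (if i < n then 1 else 0)" if "i < m + n" "j < m + n" for i j
    unfolding A[OF that] by (auto intro!: degree_diff_le)
  have carrier: "?A \<in> carrier_mat (m + n) (m + n)" using carrier_A by simp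
  note det = coeff_det_row_degrees[OF carrier deg, unfolded sum_rows]
  show "degree (as_poly_in_lambda \<Delta>) \<le> n"
    using det(1) by (simp add: eliminant_def as_poly_in_lambda_def swap.hom_det)
  have "coeff (as_poly_in_lambda \<Delta>) n = det B"
    using det(2) by (simp add: eliminant_def as_poly_in_lambda_def swap.hom_det B_def)
  also have "\<dots> = (\<Prod>i<n. - 1) * (\<Prod>k<m. [:q_dilate (q ^ k) (coeff r n):])"
  proof -
    have "B \<in> carrier_mat (n + m) (n + m)" by (simp add: B_def add.commute)
    moreover have "B $$ (i, j) = 0" if "i < j" "j < n + m" for i j
      using that by (auto simp: B_def A r_above)
    ultimately have "det B = (\<Prod>i<n. B $$ (i, i)) * (\<Prod>i<m. B $$ (n + i, n + i))"
      by (rule det_lower_triangular_split)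
    also have "\<dots> = (\<Prod>i<n. - 1) * (\<Prod>k<m. [:q_dilate (q ^ k) (coeff r n):])"
      using n_pos by (intro arg_cong2[of _ _ _ _ "(*)"] prod.cong refl) (auto simp: B_def A r_top)
    finally show ?thesis .
  qed
  also have "\<dots> = [:(- 1) ^ n * (\<Prod>k<m. q_dilate (q ^ k) (coeff r n)):]"
    by (simp add: const_poly_prod const_poly_neg_one_power)
  finally show "coeff (as_poly_in_lambda \<Delta>) n
    = [:(- 1) ^ n * (\<Prod>k<m. q_dilate (q ^ k) (coeff r n)):]" .
qed

lemma degree_eliminant_X:
  assumes "\<And>j. degree (coeff p j) \<le> a" and "\<And>j. degree (coeff r j) \<le> b"
  shows "degree (as_poly_in_X \<Delta>) \<le> n * a + m * b"
proof -
  interpret X: comm_ring_hom "as_poly_in_X :: 'a poly poly poly \<Rightarrow> _"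
    by (rule as_poly_in_X_comm_ring_hom)
  have carrier: "map_mat as_poly_in_X A \<in> carrier_mat (m + n) (m + n)" using carrier_A by simp
  have const: "degree (as_poly_in_X ([:[:c:]:] - d)) \<le> k"
    if "degree c \<le> k" "d = [:[:0, 1:]:] \<or> d = [:0, 1:] \<or> d = 0" for c :: "'a poly" and d k
    using that
    by (intro degree_le allI impI poly_eqI)
      (auto simp: coeff_as_poly_in_X coeff_pCons coeff_eq_0 split: nat.splits)
  have "degree (map_mat as_poly_in_X A $$ (i, j)) \<le> (if i < n then a else b)"
    if "i < m + n" "j < m + n" for i j
  proof (cases "i < n")
    case True
    have "degree (as_poly_in_X (A $$ (i, j))) \<le> a"
      unfolding A_upper[OF True that(2)]
      by (rule const[OF degree_coeff_left_D_funpow]) (use assms(1) in auto)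
    then show ?thesis using that carrier_A True by simp
  next
    case False
    have "degree (as_poly_in_X (A $$ (i, j))) \<le> b"
      unfolding A_lower[OF False that]
      by (rule const[OF degree_coeff_left_D_funpow]) (use assms(2) in auto)
    then show ?thesis using that carrier_A False by simp
  qed
  from coeff_det_row_degrees(1)[OF carrier this, unfolded sum_rows] show ?thesis
    by (simp add: eliminant_def X.hom_det)
qed

text \<open>The entries are built from elements of \<open>?E\<close>, 0 and 1 by ring operations,
  hence so is the determinant, without adjoining \<open>q\<close>.\<close>

lemma coeff_eliminant_in_subring:
  "coeff (coeff (coeff \<Delta> b) a) i
    \<in> gen_subring (eliminant_coeffs q m n (normal_op q p) (normal_op q r))"
    (is "_ \<in> gen_subring ?E")
proof -
  define S where "S = gen_subring ?E"
  have S: "subring_set S" "?E \<subseteq> S"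
    by (simp_all add: S_def subring_set_gen_subring gen_subring_superset)
  have S3: "subring_set {\<Phi>. \<forall>i. coeff \<Phi> i \<in> {\<phi>. \<forall>i. coeff \<phi> i \<in> {f. \<forall>i. coeff f i \<in> S}}}"
    by (intro subring_set_coeffs S)
  have p: "coeff (coeff ((left_D q ^^ k) p) j) i \<in> S" if "k < n" for k j i
  proof (cases "j \<le> m + k")
    case True
    then have "coeff (coeff ((left_D q ^^ k) p) j) i \<in> ?E"
      using that unfolding eliminant_coeffs_def D_coeff_D_op_power by blast
    then show ?thesis using S by blast
  qed (simp add: p_above subring_set_zero[OF S(1)])
  have r: "coeff (coeff ((left_D q ^^ k) r) j) i \<in> S" if "k < m" for k j i
  proof (cases "j \<le> n + k")
    case True
    then have "coeff (coeff ((left_D q ^^ k) r) j) i \<in> ?E"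
      using that unfolding eliminant_coeffs_def D_coeff_D_op_power by blast
    then show ?thesis using S by blast
  qed (simp add: r_above subring_set_zero[OF S(1)])
  have "A $$ (i, j) \<in> {\<Phi>. \<forall>i. coeff \<Phi> i \<in> {\<phi>. \<forall>i. coeff \<phi> i \<in> {f. \<forall>i. coeff f i \<in> S}}}"
    if "i < m + n" "j < m + n" for i j
    using that
    by (cases "i < n")
      (auto simp: A_upper A_lower coeff_pCons p r subring_set_zero[OF S(1)] subring_set_one[OF S(1)]
        subring_set_uminus[OF S(1) subring_set_one[OF S(1)]]
        split: nat.splits intro!: subring_set_diff[OF S(1)])
  then have "\<Delta> \<in> {\<Phi>. \<forall>i. coeff \<Phi> i \<in> {\<phi>. \<forall>i. coeff \<phi> i \<in> {f. \<forall>i. coeff f i \<in> S}}}"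
    unfolding eliminant_def by (intro subring_set_det[OF S3 carrier_A])
  then show ?thesis by (simp add: S_def)
qed

text \<open>Row \<open>i\<close> applied to the vector of powers of \<open>D\<close> expands
  \<open>D^i P\<close> in normal form and subtracts \<open>D^i P\<close>, with \<lambda> acting from
  the right; the rows of \<open>Q\<close> are analogous.\<close>

lemma eliminant_annihilates:
  assumes comm: "normal_op q p * normal_op q r = normal_op q r * normal_op q p"
  shows "lambda_mu_scale (normal_op q p) (normal_op q r) \<Delta> 1 = 0"
proof -
  let ?P = "normal_op q p" and ?Q = "normal_op q r"
  let ?s = "lambda_mu_scale ?P ?Q"
  interpret S1: module_endo M_scale "\<lambda>v. v * ?P"
    by (rule module_endo_right_mult)
  interpret S2: module_endo "lambda_scale ?P" "\<lambda>v. v * ?Q"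
    by (rule module_endo_lambda_scale[OF comm])
  interpret S3: Modules.module ?s
    by (rule S2.module_poly_scale)
  have vals: "?s [:[:c:]:] v = poly_end c M_op * v" "?s [:[:0, 1:]:] v = v * ?P"
    "?s [:0, 1:] v = v * ?Q" for c v
    by (simp_all add: S2.poly_scale_pCons S2.poly_scale_0 S1.poly_scale_pCons S1.poly_scale_0
        poly_end_0 poly_end_1 flip: one_pCons)
  have row: "(\<Sum>j<m + n. poly_end (coeff c j) M_op * D_op q ^ j) = normal_op q c"
    if "degree c < m + n" for c
  proof -
    have "{..<m + n} = {..m + n - 1}" using m_pos by auto
    then show ?thesis using that by (simp add: normal_op_upto[of c "m + n - 1"] normal_form_def)
  qed
  have ker: "(\<Sum>j<m + n. ?s (A $$ (i, j)) (D_op q ^ j)) = 0" if i: "i < m + n" for i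
  proof (cases "i < n")
    case True
    have "?s (A $$ (i, j)) (D_op q ^ j) = poly_end (coeff ((left_D q ^^ i) p) j) M_op * D_op q ^ j
        - (if j = i then D_op q ^ i * ?P else 0)" if "j < m + n" for j
      using True that by (simp add: A_upper S3.scale_left_diff_distrib vals)
    then have "(\<Sum>j<m + n. ?s (A $$ (i, j)) (D_op q ^ j))
        = normal_op q ((left_D q ^^ i) p) - D_op q ^ i * ?P"
      using True i degree_left_D_funpow[of p m i q] degree_p by (simp add: sum_subtractf row)
    then show ?thesis by (simp add: normal_op_left_D_funpow[OF q_nonzero])
  next
    case False
    have "?s (A $$ (i, j)) (D_op q ^ j)
        = poly_end (coeff ((left_D q ^^ (i - n)) r) j) M_op * D_op q ^ j
        - (if j = i - n then D_op q ^ (i - n) * ?Q else 0)" if "j < m + n" for j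
      using False that i by (simp add: A_lower S3.scale_left_diff_distrib vals)
    then have "(\<Sum>j<m + n. ?s (A $$ (i, j)) (D_op q ^ j))
        = normal_op q ((left_D q ^^ (i - n)) r) - D_op q ^ (i - n) * ?Q"
      using False i degree_left_D_funpow[of r n "i - n" q] degree_r less_imp_diff_less[OF i, of n]
      by (simp add: sum_subtractf row)
    then show ?thesis by (simp add: normal_op_left_D_funpow[OF q_nonzero])
  qed
  \<comment> \<open>Component 0 of the vector is \<open>D_op q ^ 0 = 1\<close>.\<close>
  show ?thesis
    using S3.det_scale_eq_0[OF carrier_A ker, of 0] m_pos by (simp add: eliminant_def)
qed

text \<open>The substituted coefficients lie in the algebra and commute with \<open>P\<close>, so
  the vanishing sum over powers of \<open>M_op\<close> forces each of them to vanish.\<close>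

lemma poly2_end_coeff_eliminant:
  assumes comm: "normal_op q p * normal_op q r = normal_op q r * normal_op q p"
    and heis: "normal_op q p \<in> q_heisenberg q" "normal_op q r \<in> q_heisenberg q"
    and s: "degree (as_poly_in_X \<Delta>) \<le> s" "i \<le> s"
  shows "poly2_end (coeff (as_poly_in_X \<Delta>) i) (normal_op q p) (normal_op q r) = 0"
proof -
  let ?T = "\<lambda>i. poly2_end (coeff (as_poly_in_X \<Delta>) i) (normal_op q p) (normal_op q r)"
  have "\<exists>c. \<forall>i. ?T i = normal_op q (c i)"
    by (intro choice allI q_heisenberg_normal_op[OF q_nonzero] q_heisenberg_poly2_end heis)
  then obtain c where c: "\<And>i. ?T i = normal_op q (c i)" by blast
  have "c i = 0"
  proof (rule M_powers_independent_over_commutant[OF q_nonzero q_int_eq_0 _ _ _ s(2)])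
    show "0 < degree p" using degree_p m_pos by simp
    show "normal_op q p * normal_op q (c i) = normal_op q (c i) * normal_op q p" for i
      unfolding c[symmetric] by (rule poly2_end_commute[OF refl comm])
    show "(\<Sum>i\<le>s. M_op ^ i * normal_op q (c i)) = 0"
      unfolding c[symmetric] lambda_mu_scale_one[OF comm s(1), symmetric]
      by (rule eliminant_annihilates[OF comm])
  qed
  then show ?thesis by (simp add: c normal_op_0)
qed

end

lemma q_dilate_prod_nonzero:
  "q \<noteq> 0 \<Longrightarrow> c \<noteq> 0 \<Longrightarrow> (\<Prod>k<n. q_dilate (q ^ k) c) \<noteq> 0"
  by (simp add: pcompose_eq_0_iff)

lemma normal_form_eq_normal_op:
  "\<exists>p. degree p \<le> N \<and> (\<forall>j. coeff p j = (if j \<le> N then c j else 0))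
    \<and> (\<Sum>j\<le>N. poly_end (c j) M_op * D_op q ^ j) = normal_op q p"
proof -
  obtain p where p: "degree p \<le> N" "coeff p = (\<lambda>j. if j \<le> N then c j else 0)"
    using ex_poly_coeff_eq[of N "\<lambda>j. if j \<le> N then c j else 0"] by auto
  then show ?thesis
    by (intro exI[of _ p]) (simp add: normal_op_upto normal_form_def)
qed

theorem theorem2p4:
  fixes q :: "'a::field"
    and m n s t :: nat
    and pc qc :: "nat \<Rightarrow> 'a poly"
    and P Q :: "'a laurent_end"
    and \<Delta> :: "'a poly poly poly"
    and \<delta> :: "nat \<Rightarrow> 'a poly poly"
    and R :: "'a set"
  assumes "q \<noteq> 0"
    and "\<forall>k::int. q_int q k = 0 \<longleftrightarrow> k = 0"
    and "m \<ge> 1" and "n \<ge> 1"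
    and "P \<in> q_heisenberg q" and "Q \<in> q_heisenberg q"
    and "P = (\<Sum>j\<le>m. poly_end (pc j) M_op * D_op q ^ j)" and "pc m \<noteq> 0"
    and "Q = (\<Sum>j\<le>n. poly_end (qc j) M_op * D_op q ^ j)" and "qc n \<noteq> 0"
    and "P * Q = Q * P"
    and "\<Delta> = eliminant q m n P Q"
    and "s = n * Max ((\<lambda>j. degree (pc j)) ` {..m}) + m * Max ((\<lambda>j. degree (qc j)) ` {..n})"
    and "t = n * (n - 1) div 2 * Max ((\<lambda>j. degree (pc j)) ` {..m})
           + m * (m - 1) div 2 * Max ((\<lambda>j. degree (qc j)) ` {..n})"
    and "\<forall>i. \<delta> i = coeff (as_poly_in_X \<Delta>) i"
    and "R = gen_subring (eliminant_coeffs q m n P Q)"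
  shows "\<Delta> \<noteq> 0
    \<and> degree (as_poly_in_lambda \<Delta>) = n
    \<and> coeff (as_poly_in_lambda \<Delta>) n
        = [:(- 1) ^ n * (\<Prod>k<m. pcompose (qc n) [:0, q ^ k:]):]
    \<and> coeff (as_poly_in_lambda \<Delta>) n \<noteq> 0
    \<and> degree \<Delta> = m
    \<and> coeff \<Delta> m
        = [:(- 1) ^ (m * (n + 1)) * (\<Prod>k<n. pcompose (pc m) [:0, q ^ k:]):]
    \<and> coeff \<Delta> m \<noteq> 0
    \<and> degree (as_poly_in_X \<Delta>) \<le> s
    \<and> as_poly_in_X \<Delta> = (\<Sum>i\<le>s. monom (\<delta> i) i)
    \<and> (\<forall>i\<le>s. \<forall>a b. coeff (coeff (\<delta> i) b) a \<in> gen_subring (insert q R)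
          \<and> (\<exists>r. (\<forall>l\<le>t. r l \<in> R) \<and> coeff (coeff (\<delta> i) b) a = (\<Sum>l\<le>t. r l * q ^ l)))
    \<and> (\<exists>i\<le>s. \<delta> i \<noteq> 0)
    \<and> (\<forall>i\<le>s. poly2_end (\<delta> i) P Q = 0)"
proof -
  \<comment> \<open>\<open>pc\<close> and \<open>qc\<close> are arbitrary beyond \<open>m\<close>
    and \<open>n\<close>, so they are cut off there to become polynomials.\<close>
  obtain p where p: "degree p \<le> m" "\<And>j. coeff p j = (if j \<le> m then pc j else 0)"
    "P = normal_op q p"
    using normal_form_eq_normal_op[of m pc q] assms(7) by auto
  obtain r where r: "degree r \<le> n" "\<And>j. coeff r j = (if j \<le> n then qc j else 0)"
    "Q = normal_op q r"
    using normal_form_eq_normal_op[of n qc q] assms(9) by auto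
  have "degree p = m" "degree r = n"
    using p(1) r(1) p(2)[of m] r(2)[of n] assms(8,10) le_degree[of p m] le_degree[of r n] by auto
  then interpret heisenberg_pair q m n p r
    using assms(1-4) by unfold_locales auto
  have \<Delta>: "\<Delta> = eliminant q m n (normal_op q p) (normal_op q r)"
    by (simp add: assms(12) p(3) r(3))
  have lam: "degree (as_poly_in_lambda \<Delta>) \<le> n" "coeff (as_poly_in_lambda \<Delta>) n
      = [:(- 1) ^ n * (\<Prod>k<m. pcompose (qc n) [:0, q ^ k:]):]"
    using degree_eliminant_lambda coeff_eliminant_lambda by (simp_all add: \<Delta> r(2))
  have mu: "degree \<Delta> \<le> m" "coeff \<Delta> m
      = [:(- 1) ^ (m * (n + 1)) * (\<Prod>k<n. pcompose (pc m) [:0, q ^ k:]):]"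
    using degree_eliminant_mu coeff_eliminant_mu by (simp_all add: \<Delta> p(2))
  have lam_nz: "coeff (as_poly_in_lambda \<Delta>) n \<noteq> 0"
    using q_dilate_prod_nonzero[OF assms(1,10), of m] by (simp add: lam(2))
  have mu_nz: "coeff \<Delta> m \<noteq> 0"
    using q_dilate_prod_nonzero[OF assms(1,8), of n] by (simp add: mu(2))
  have deg: "degree (as_poly_in_lambda \<Delta>) = n" "degree \<Delta> = m"
    using lam(1) mu(1) le_degree[OF lam_nz] le_degree[OF mu_nz] by simp_all
  have nz: "\<Delta> \<noteq> 0" using mu_nz by auto
  have s: "degree (as_poly_in_X \<Delta>) \<le> s"
    unfolding assms(13) \<Delta> by (rule degree_eliminant_X) (auto simp: p(2) r(2) intro!: Max_ge)
  have X: "as_poly_in_X \<Delta> = (\<Sum>i\<le>s. monom (\<delta> i) i)"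
    using poly_as_sum_of_monoms'[OF s] assms(15) by simp
  have "as_poly_in_X \<Delta> \<noteq> 0"
  proof
    assume "as_poly_in_X \<Delta> = 0"
    then have "\<Delta> = 0"
      using coeff_as_poly_in_X[of \<Delta>] by (intro poly_eqI) simp
    with nz show False by simp
  qed
  then have ex: "\<exists>i\<le>s. \<delta> i \<noteq> 0"
    using X by (metis (no_types, lifting) atMost_iff monom_eq_0_iff sum.neutral)
  have R: "coeff (coeff (\<delta> i) b) a \<in> R" for i a b
    using coeff_eliminant_in_subring[of b a i]
    by (simp add: assms(15,16) \<Delta> p(3) r(3) coeff_as_poly_in_X)
  have "subring_set R" by (simp add: assms(16) subring_set_gen_subring)
  \<comment> \<open>Elements of \<open>R\<close> have the required form with constant term
    \<open>x\<close> and all other coefficients zero.\<close>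
  then have "\<exists>f. (\<forall>l\<le>t. f l \<in> R) \<and> x = (\<Sum>l\<le>t. f l * q ^ l)" if "x \<in> R" for x
    using that subring_set_zero
    by (intro exI[of _ "\<lambda>l. if l = 0 then x else 0"]) (auto simp: if_distrib[of "\<lambda>y. y * _"] cong: if_cong)
  moreover have "R \<subseteq> gen_subring (insert q R)"
    using gen_subring_superset by blast
  moreover have "poly2_end (\<delta> i) P Q = 0" if "i \<le> s" for i
    using poly2_end_coeff_eliminant[OF _ _ _ _ that] assms(5,6,11) s
    by (simp add: assms(15) \<Delta> p(3) r(3))
  ultimately show ?thesis
    using nz deg lam(2) lam_nz mu(2) mu_nz s X ex R by blast
qed

end
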